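(* Let $m,d\ge1$ be integers such that $\nu:=m/d\ge1$. Let $i_\nu:=\lfloor\frac{\nu-1}2\rfloor$. Then $$\inf_L\sup_D\mathfrak R_m(L,D)\ \ge\ B_1(\nu)\ \ge\ B_2(\nu):=\frac{c_\nu}{\sqrt\nu},$$ where $\inf_L$ is either $\inf_{L\in\mathcal L}$ or $\inf_{L\in\mathcal L_{\mathsf{rand}}}$ (the inequalities hold in both cases), $\sup_D$ is over all probability distributions $D$ on $[d]\times\{-1,1\}$, $$c_\nu:=\frac{z_*}2\,\Big(1-C_{i_\nu}\frac{\operatorname{erf}(z_*/\sqrt2)}{\exp\{-z_*^2/(6\nu)\}}\Big)<c_\infty,\qquad C_i=\frac{\sqrt{\pi(i+1/2)}}{2^{2i}}\binom{2i}i\quad(i=0,1,\dots).$$ Moreover, for $\nu\ge3$, $$B_2(\nu)\ge\tilde B_2(\nu):=\frac{\tilde c_\nu}{\sqrt\nu},\qquad\text{where}\qquad\tilde c_\nu:=\frac{z_*}2\,\bigg(1-\Big(\frac{i_\nu+1}{i_\nu}\Big)^{1/8}\frac{\operatorname{erf}(z_*/\sqrt2)}{\exp\{-z_*^2/(6\nu)\}}\bigg)\le c_\nu.$$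
   Context: Setting: $\mathcal X=[d]=\{1,\dots,d\}$, $\mathcal Y=\{-1,1\}$, $\mathcal H=\mathcal Y^{\mathcal X}$. For a probability distribution $D$ on $\mathcal X\times\mathcal Y$, $(X^D,Y^D)$ is a random pair with distribution $D$, and $Z_m^D$ is the sequence of $m$ independent copies of it. Put $\operatorname{err}(h,D)=\mathsf P(h(X^D)\ne Y^D)$ and $\Delta(h,D)=\operatorname{err}(h,D)-\min_{g\in\mathcal H}\operatorname{err}(g,D)$. $\mathcal L$ is the set of all (non-randomized) learning algorithms, i.e. maps $L\colon(\mathcal X\times\mathcal Y)^m\to\mathcal H$; $\mathcal L_{\mathsf{rand}}$ is the set of all randomized learning algorithms, i.e. maps $L\colon(\mathcal X\times\mathcal Y)^m\times[-1,1]\to\mathcal H$ (measurable in the last argument). The expected excess risk is $\mathfrak R_m(L,D):=\mathsf E\,\Delta(L(Z_m^D),D)$ for $L\in\mathcal L$ and $\mathfrak R_m(L,D):=\mathsf E\,\Delta(L(Z_m^D,U),D)$ for $L\in\mathcal L_{\mathsf{rand}}$, with $U$ uniform on $[-1,1]$ and independent of $Z_m^D$. $\operatorname{erf}(u)=\frac2{\sqrt\pi}\int_0^ue^{-t^2}dt$. $z_*=0.75179\dots$ is the unique maximizer of $\frac z2\big(1-\operatorname{erf}(z/\sqrt2)\big)$ over real $z>0$, and $c_\infty=0.16997\dots$ is the maximum value. For $k\in\{0,1,\dots\}$ and $b\in[-1,1]$: $V^b_k:=Y^b_1+\dots+Y^b_k$, where the $Y^b_i$ are iid with $\mathsf P(Y^b_i=1)=\frac{1+b}2$,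 $\mathsf P(Y^b_i=-1)=\frac{1-b}2$ (so $V^b_0=0$); $s_k(b):=|\mathsf P(V^b_k>0)-\mathsf P(V^{-b}_k>0)|$; $\operatorname{bayes}(k,b):=\frac12\big(1-s_k(b)\big)$. For $b\in[0,1]$, $\kappa\mapsto\check{\operatorname{bayes}}(\kappa,b)$ on $[0,\infty)$ is the linear interpolation of $k\mapsto\operatorname{bayes}(k,b)$ at the points $0,1,3,5,\dots$: it equals $(1-\kappa)\operatorname{bayes}(0,b)+\kappa\operatorname{bayes}(1,b)$ for $0\le\kappa\le1$ and $\frac{2i+3-\kappa}2\operatorname{bayes}(2i+1,b)+\frac{\kappa-2i-1}2\operatorname{bayes}(2i+3,b)$ for $2i+1\le\kappa\le2i+3$, $i=0,1,\dots$. Finally, $B_1(\nu):=\sup_{b\in(0,1)}b\,\check{\operatorname{bayes}}(\nu,b)$. *)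

theory Defs
  imports "HOL-Probability.Probability"
begin

subsection \<open>Learning over the domain \<open>[d]\<close> with labels \<open>{-1, 1}\<close>\<close>

text \<open>
  All risks below take values in \<open>[0, 1]\<close> and the sets of algorithms and of distributions are
  nonempty for \<open>d \<ge> 1\<close>, so their real-valued infima and suprema are the usual ones.
\<close>

definition labels :: "int set" where
  "labels = {-1, 1}"

definition hypotheses :: "nat \<Rightarrow> (nat \<Rightarrow> int) set" where
  "hypotheses d = {1..d} \<rightarrow>\<^sub>E labels"

text \<open>A distribution on the finite set \<open>[d] \<times> {-1, 1}\<close> is a mass function supported there.\<close>

definition distributions :: "nat \<Rightarrow> (nat \<times> int) pmf set" where
  "distributions d = {D. set_pmf D \<subseteq> {1..d} \<times> labels}"

definition samples :: "nat \<Rightarrow> nat \<Rightarrow> (nat \<times> int) list set" where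
  "samples m d = {z. length z = m \<and> set z \<subseteq> {1..d} \<times> labels}"

definition err :: "(nat \<Rightarrow> int) \<Rightarrow> (nat \<times> int) pmf \<Rightarrow> real" where
  "err h D = measure_pmf.prob D {(x, y). h x \<noteq> y}"

definition excess :: "nat \<Rightarrow> (nat \<Rightarrow> int) \<Rightarrow> (nat \<times> int) pmf \<Rightarrow> real" where
  "excess d h D = err h D - (MIN g\<in>hypotheses d. err g D)"

definition learners :: "nat \<Rightarrow> nat \<Rightarrow> ((nat \<times> int) list \<Rightarrow> nat \<Rightarrow> int) set" where
  "learners m d = samples m d \<rightarrow> hypotheses d"

definition risk :: "nat \<Rightarrow> nat \<Rightarrow> ((nat \<times> int) list \<Rightarrow> nat \<Rightarrow> int) \<Rightarrow> (nat \<times> int) pmf \<Rightarrow> real" where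
  "risk m d L D = measure_pmf.expectation (replicate_pmf m D) (\<lambda>z. excess d (L z) D)"

text \<open>
  The law of \<open>U\<close> is a measure on the space \<open>[-1, 1]\<close> itself and, in the randomized risk, the
  law of the sample is a measure on \<open>samples m d\<close>. A randomized algorithm is measurable in its last
  argument only on these sets; on larger spaces the integrand could fail to be
  measurable, and its Bochner integral would then be \<open>0\<close> by convention.
\<close>

definition unif :: "real measure" where
  "unif = uniform_measure (restrict_space lborel {-1..1}) {-1..1}"

definition rand_learners :: "nat \<Rightarrow> nat \<Rightarrow> ((nat \<times> int) list \<Rightarrow> real \<Rightarrow> nat \<Rightarrow> int) set" where
  "rand_learners m d = samples m d \<rightarrow> (unif \<rightarrow>\<^sub>M count_space (hypotheses d))"

definition rand_risk ::
    "nat \<Rightarrow> nat \<Rightarrow> ((nat \<times> int) list \<Rightarrow> real \<Rightarrow> nat \<Rightarrow> int) \<Rightarrow> (nat \<times> int) pmf \<Rightarrow> real" where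
  "rand_risk m d L D =
     (\<integral>(z, u). excess d (L z u) D
        \<partial>(restrict_space (measure_pmf (replicate_pmf m D)) (samples m d) \<Otimes>\<^sub>M unif))"

subsection \<open>The error function and the constants \<open>z\<^sub>*\<close> and \<open>c\<^sub>\<infinity>\<close>\<close>

definition erf :: "real \<Rightarrow> real" where
  "erf u = 2 / sqrt pi * (LBINT t=0..u. exp (- t\<^sup>2))"

definition z_objective :: "real \<Rightarrow> real" where
  "z_objective z = z / 2 * (1 - erf (z / sqrt 2))"

definition z_star :: real where
  "z_star = (THE z. z > 0 \<and> (\<forall>w>0. z_objective w \<le> z_objective z))"

definition c_inf :: real where
  "c_inf = z_objective z_star"

subsection \<open>The bounds\<close>

text \<open>The laws of \<open>Y\<^sup>b\<close> and \<open>V\<^sup>b\<^sub>k\<close>, meaningful for \<open>b \<in> [-1, 1]\<close>.\<close>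

definition Y_pmf :: "real \<Rightarrow> int pmf" where
  "Y_pmf b = map_pmf (\<lambda>c. if c then 1 else -1) (bernoulli_pmf ((1 + b) / 2))"

definition V_pmf :: "nat \<Rightarrow> real \<Rightarrow> int pmf" where
  "V_pmf k b = map_pmf sum_list (replicate_pmf k (Y_pmf b))"

definition s_gap :: "nat \<Rightarrow> real \<Rightarrow> real" where
  "s_gap k b = \<bar>measure_pmf.prob (V_pmf k b) {v. v > 0} - measure_pmf.prob (V_pmf k (- b)) {v. v > 0}\<bar>"

definition bayes :: "nat \<Rightarrow> real \<Rightarrow> real" where
  "bayes k b = (1 - s_gap k b) / 2"

text \<open>Linear interpolation of \<open>bayes\<close> in its first argument at the nodes \<open>0, 1, 3, 5, \<dots>\<close>;
  the pieces agree at the nodes.\<close>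

definition bayes_interp :: "real \<Rightarrow> real \<Rightarrow> real" where
  "bayes_interp \<kappa> b =
     (if \<kappa> \<le> 1 then (1 - \<kappa>) * bayes 0 b + \<kappa> * bayes 1 b
      else let i = nat \<lfloor>(\<kappa> - 1) / 2\<rfloor> in
        (2 * real i + 3 - \<kappa>) / 2 * bayes (2 * i + 1) b +
        (\<kappa> - 2 * real i - 1) / 2 * bayes (2 * i + 3) b)"

definition B1 :: "real \<Rightarrow> real" where
  "B1 \<nu> = (SUP b\<in>{0<..<1}. b * bayes_interp \<nu> b)"

definition idx :: "real \<Rightarrow> nat" where
  "idx \<nu> = nat \<lfloor>(\<nu> - 1) / 2\<rfloor>"

definition C_coef :: "nat \<Rightarrow> real" where
  "C_coef i = sqrt (pi * (real i + 1 / 2)) / 2 ^ (2 * i) * real ((2 * i) choose i)"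

definition c_nu :: "real \<Rightarrow> real" where
  "c_nu \<nu> = z_star / 2 * (1 - C_coef (idx \<nu>) * (erf (z_star / sqrt 2) / exp (- (z_star\<^sup>2 / (6 * \<nu>)))))"

definition B2 :: "real \<Rightarrow> real" where
  "B2 \<nu> = c_nu \<nu> / sqrt \<nu>"

definition c_tilde :: "real \<Rightarrow> real" where
  "c_tilde \<nu> = z_star / 2 *
     (1 - ((real (idx \<nu>) + 1) / real (idx \<nu>)) powr (1 / 8) *
        (erf (z_star / sqrt 2) / exp (- (z_star\<^sup>2 / (6 * \<nu>)))))"

definition B2_tilde :: "real \<Rightarrow> real" where
  "B2_tilde \<nu> = c_tilde \<nu> / sqrt \<nu>"

end

theory Submission
  imports Defs
begin

text \<open>
  Draw the labelling \<open>\<theta>\<close> uniformly at random and let \<open>D\<close> have uniform \<open>X\<close> and \<open>Y = \<theta>(X)\<close> with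
  probability \<open>(1 + b)/2\<close>. Pairing \<open>\<theta>\<close> with its flip at \<open>x\<close>, the two error probabilities at \<open>x\<close> add
  up to at least \<open>E min(1, r^V)\<close>, where \<open>r = (1 - b)/(1 + b)\<close> and \<open>V\<close> is the sum of the labels seen
  at \<open>x\<close>, signed by \<open>\<theta>(x)\<close>: a random walk with drift \<open>b\<close> that moves with probability \<open>1/d\<close> at each of
  \<open>m\<close> times. For \<open>k\<close> actual steps this expectation is \<open>2 bayes(k, b)\<close>, and it drops by \<open>b P(V_k = 0)\<close>
  at the next step, so that \<open>1 - 2 bayes(2 i + 1, b) = b (\<Sum>j\<le>i. c_j (1 - b^2)^j)\<close> with
  \<open>c_j = (2j choose j) / 4^j\<close>. The summands decrease in \<open>j\<close>, so the interpolation is convex with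
  supporting lines below all values \<open>bayes(k, b)\<close>, and Jensen's inequality replaces the binomial
  number of steps by its mean \<open>\<nu> = m/d\<close>. Randomized algorithms are averaged over \<open>U\<close>.

  For \<open>B1 \<ge> B2\<close> take \<open>b = z_* / sqrt \<nu>\<close>. The sum above has derivative \<open>(2i + 1) c_i (1 - b^2)^i\<close> and is
  at most \<open>C_i erf(b sqrt(i + 1/2)) exp(b^2/6)\<close>. As \<open>C_i\<close> decreases (to \<open>1\<close>, by Wallis), this bound
  with \<open>C_i\<close> holds at both nodes \<open>2i + 1\<close>, \<open>2i + 3\<close>, and it extends between them since
  \<open>erf(b sqrt(\<nu>/2))\<close> is concave in \<open>\<nu>\<close>. Finally \<open>z_* < 1\<close>, so that \<open>b < 1\<close>, is Mills' inequality
  for the normal tail at \<open>1\<close>.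
\<close>

section \<open>Central binomial coefficients and \<open>C_i\<close>\<close>

text \<open>The probability that a symmetric simple random walk is back at 0 after
  \<open>2 * i\<close> steps.\<close>

definition cbin :: "nat \<Rightarrow> real" where
  "cbin i = real ((2 * i) choose i) / 4 ^ i"

lemma cbin_0 [simp]: "cbin 0 = 1"
  by (simp add: cbin_def)

lemma cbin_pos: "cbin i > 0"
  by (simp add: cbin_def)

lemma cbin_fact: "cbin i = fact (2 * i) / ((fact i)\<^sup>2 * 4 ^ i)"
  using binomial_fact[of i "2 * i", where 'a = real]
  by (simp add: cbin_def power2_eq_square)

lemma cbin_Suc: "2 * (real i + 1) * cbin (Suc i) = (2 * real i + 1) * cbin i"
proof -
  define x where "x = real i"
  have x: "x \<ge> 0" by (simp add: x_def)
  have "(fact (2 * Suc i) :: real) = (2 * x + 2) * ((2 * x + 1) * fact (2 * i))"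
    by (simp add: algebra_simps x_def)
  moreover have "(fact (Suc i) :: real) = (x + 1) * fact i"
    by (simp add: x_def)
  moreover have "(4 ^ Suc i :: real) = 4 * 4 ^ i" by simp
  ultimately have "cbin (Suc i) =
      ((2 * x + 2) * ((2 * x + 1) * fact (2 * i))) / (((x + 1) * fact i)\<^sup>2 * (4 * 4 ^ i))"
    by (simp only: cbin_fact)
  also have "\<dots> = (2 * x + 1) / (2 * (x + 1)) * cbin i"
    unfolding cbin_fact using x
    by (simp add: divide_simps) (simp add: power2_eq_square algebra_simps)
  finally show ?thesis using x by (simp add: x_def)
qed

lemma cbin_antimono: "cbin (Suc i) \<le> cbin i"
proof -
  have "2 * (real i + 1) * cbin (Suc i) \<le> 2 * (real i + 1) * cbin i"
    unfolding cbin_Suc using cbin_pos[of i] by (intro mult_right_mono) auto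
  then show ?thesis by simp
qed

text \<open>By \<open>cbin_Suc\<close> the right-hand side grows by exactly
  \<open>cbin (Suc i)\<close> when \<open>i\<close> grows by one.\<close>

lemma sum_cbin: "(\<Sum>j\<le>i. cbin j) = (2 * real i + 1) * cbin i"
proof (induction i)
  case (Suc i)
  then show ?case using cbin_Suc[of i] by (simp add: algebra_simps)
qed simp

lemma C_coef_eq: "C_coef i = sqrt (pi * (real i + 1 / 2)) * cbin i"
  by (simp add: C_coef_def cbin_def power_mult)

lemma C_coef_pos: "C_coef i > 0"
  unfolding C_coef_eq using cbin_pos[of i] by (simp add: add_pos_nonneg)

text \<open>The product is that of Wallis, with limit \<open>pi / 2\<close>; the identity turns this
  limit into that of \<open>C_coef\<close>.\<close>

lemma cbin_wallis:
  "(cbin n)\<^sup>2 * (2 * real n + 1) * (\<Prod>k=1..n. (4 * (real k)\<^sup>2) / (4 * (real k)\<^sup>2 - 1)) = 1"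
proof (induction n)
  case (Suc n)
  define x where "x = real n"
  define P where "P = (\<Prod>k=1..n. (4 * (real k)\<^sup>2) / (4 * (real k)\<^sup>2 - 1))"
  have x: "x \<ge> 0" by (simp add: x_def)
  have *: "cbin (Suc n) = (2 * x + 1) / (2 * (x + 1)) * cbin n"
    using cbin_Suc[of n] x by (simp add: field_simps x_def)
  have **: "4 * (x + 1)\<^sup>2 - 1 = (2 * x + 1) * (2 * x + 3)"
    by (simp add: power2_eq_square algebra_simps)
  have "(cbin (Suc n))\<^sup>2 * (2 * real (Suc n) + 1) *
      (\<Prod>k=1..Suc n. (4 * (real k)\<^sup>2) / (4 * (real k)\<^sup>2 - 1))
      = (cbin (Suc n))\<^sup>2 * (2 * x + 3) * (P * (4 * (x + 1)\<^sup>2 / (4 * (x + 1)\<^sup>2 - 1)))"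
    by (simp add: P_def x_def algebra_simps)
  also have "\<dots> = (cbin n)\<^sup>2 * (2 * x + 1) * P"
    unfolding * ** using x by (simp add: divide_simps) (simp add: power2_eq_square algebra_simps)
  also have "\<dots> = 1" using Suc by (simp only: x_def P_def)
  finally show ?case .
qed simp

lemma C_coef_tendsto: "C_coef \<longlonglongrightarrow> 1"
proof -
  define P :: "nat \<Rightarrow> real" where
    "P = (\<lambda>n. \<Prod>k=1..n. (4 * (real k)\<^sup>2) / (4 * (real k)\<^sup>2 - 1))"
  have C: "C_coef = (\<lambda>n. sqrt (pi / 2 / P n))"
  proof
    fix n
    have 1: "(cbin n)\<^sup>2 * (2 * real n + 1) * P n = 1"
      using cbin_wallis[of n] by (simp add: P_def)
    then have P: "P n \<noteq> 0" by auto
    have "(C_coef n)\<^sup>2 = pi / 2 * ((cbin n)\<^sup>2 * (2 * real n + 1))"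
      by (simp add: C_coef_eq power_mult_distrib algebra_simps)
    also have "(cbin n)\<^sup>2 * (2 * real n + 1) = 1 / P n" using 1 P by (simp add: eq_divide_eq)
    also have "pi / 2 * (1 / P n) = pi / 2 / P n" by simp
    finally show "C_coef n = sqrt (pi / 2 / P n)"
      using C_coef_pos[of n] by (metis real_sqrt_unique less_imp_le)
  qed
  have "(\<lambda>n. sqrt (pi / 2 / P n)) \<longlonglongrightarrow> sqrt (pi / 2 / (pi / 2))"
    using wallis by (intro tendsto_intros) (auto simp: P_def)
  then show ?thesis unfolding C by simp
qed

text \<open>Squaring removes the square root. The last factor is
  \<open>1 - 1 / (2 * (real i + 1))\<^sup>2\<close>, which is below 1 and makes
  \<open>C_coef\<close> decrease.\<close>

lemma C_coef_Suc_sq: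
  "(C_coef (Suc i))\<^sup>2 = (C_coef i)\<^sup>2 * (((2 * real i + 1) * (2 * real i + 3)) / (2 * (real i + 1))\<^sup>2)"
proof -
  define x where "x = real i"
  have x: "x \<ge> 0" by (simp add: x_def)
  have *: "cbin (Suc i) = (2 * x + 1) / (2 * (x + 1)) * cbin i"
    using cbin_Suc[of i] x by (simp add: field_simps x_def)
  have "(C_coef (Suc i))\<^sup>2 = pi * (real (Suc i) + 1 / 2) * (cbin (Suc i))\<^sup>2"
    by (simp add: C_coef_eq power_mult_distrib)
  also have "\<dots> = pi * (x + 3 / 2) * ((2 * x + 1) / (2 * (x + 1)) * cbin i)\<^sup>2"
    by (simp only: *) (simp add: x_def)
  also have "\<dots> = pi * (x + 1 / 2) * (cbin i)\<^sup>2 * (((2 * x + 1) * (2 * x + 3)) / (2 * (x + 1))\<^sup>2)"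
    using x by (simp add: divide_simps) (simp add: power2_eq_square algebra_simps)
  also have "pi * (x + 1 / 2) * (cbin i)\<^sup>2 = (C_coef i)\<^sup>2"
    using x by (simp add: C_coef_eq power_mult_distrib x_def)
  finally show ?thesis by (simp add: x_def)
qed

lemma decseq_C_coef: "decseq C_coef"
proof (rule decseq_SucI)
  fix i
  have "((2 * real i + 1) * (2 * real i + 3)) / (2 * (real i + 1))\<^sup>2 \<le> 1"
    by (simp add: divide_simps add_pos_nonneg) (simp add: power2_eq_square algebra_simps)
  then have "(C_coef (Suc i))\<^sup>2 \<le> (C_coef i)\<^sup>2 * 1"
    unfolding C_coef_Suc_sq by (intro mult_left_mono) auto
  then show "C_coef (Suc i) \<le> C_coef i"
    using C_coef_pos[of i] by (intro power2_le_imp_le[of "C_coef (Suc i)"]) auto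
qed

lemma C_coef_ge_1: "C_coef i \<ge> 1"
  using decseq_ge[OF decseq_C_coef C_coef_tendsto] .

text \<open>In eighth powers the claim is that \<open>C_coef i ^ 8 * (i / (i + 1))\<close> is at
  most 1. This quantity, \<open>D j\<close> for \<open>i = Suc j\<close>, increases and tends to
  1.\<close>

lemma C_coef_le_powr:
  assumes "i \<ge> 1"
  shows "C_coef i \<le> ((real i + 1) / real i) powr (1 / 8)"
proof -
  define D where "D = (\<lambda>j. (C_coef (Suc j)) ^ 8 * ((real j + 1) / (real j + 2)))"
  have "incseq D"
  proof (rule incseq_SucI)
    fix j
    define x where "x = real j"
    define u where "u = (x + 2)\<^sup>2"
    have x: "x \<ge> 0" by (simp add: x_def)
    have u: "u \<ge> 4" unfolding u_def using power_mono[of 2 "x + 2" 2] x by simp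
    have "(C_coef (Suc (Suc j))) ^ 8 = ((C_coef (Suc (Suc j)))\<^sup>2) ^ 4" by simp
    also have "\<dots> = ((C_coef (Suc j))\<^sup>2 * (((2 * x + 3) * (2 * x + 5)) / (2 * (x + 2))\<^sup>2)) ^ 4"
      unfolding C_coef_Suc_sq[of "Suc j"] by (simp add: x_def algebra_simps)
    also have "((2 * x + 3) * (2 * x + 5)) / (2 * (x + 2))\<^sup>2 = 1 - 1 / (4 * u)"
      using x by (simp add: u_def divide_simps) (simp add: power2_eq_square algebra_simps)
    finally have C: "(C_coef (Suc (Suc j))) ^ 8 = (C_coef (Suc j)) ^ 8 * (1 - 1 / (4 * u)) ^ 4"
      by (simp add: power_mult_distrib)
    \<comment> \<open>Bernoulli's inequality; \<open>1 - 1 / u\<close> is the quotient of the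
      consecutive factors \<open>(x + 1) / (x + 2)\<close> and \<open>(x + 2) / (x + 3)\<close> in
      \<open>D\<close>.\<close>
    have "1 - 1 / u \<le> (1 - 1 / (4 * u)) ^ 4"
    proof -
      have "1 / (4 * u) \<le> 1" using u by simp
      then have "1 + real 4 * (- (1 / (4 * u))) \<le> (1 + (- (1 / (4 * u)))) ^ 4"
        by (intro Bernoulli_inequality) linarith
      then show ?thesis by simp
    qed
    then have "(1 - 1 / u) * ((x + 2) / (x + 3)) \<le> (1 - 1 / (4 * u)) ^ 4 * ((x + 2) / (x + 3))"
      using x by (intro mult_right_mono) auto
    moreover have "(1 - 1 / u) * ((x + 2) / (x + 3)) = (x + 1) / (x + 2)"
      using x by (simp add: u_def divide_simps) (simp add: power2_eq_square algebra_simps)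
    ultimately have "(x + 1) / (x + 2) \<le> (1 - 1 / (4 * u)) ^ 4 * ((x + 2) / (x + 3))"
      by simp
    then have "C_coef (Suc j) ^ 8 * ((x + 1) / (x + 2)) \<le>
        C_coef (Suc j) ^ 8 * ((1 - 1 / (4 * u)) ^ 4 * ((x + 2) / (x + 3)))"
      by (intro mult_left_mono) auto
    then show "D j \<le> D (Suc j)"
      unfolding D_def C x_def
      by (simp only: mult.assoc of_nat_Suc add.commute add.left_commute one_add_one) (simp add: add_ac)
  qed
  moreover have "D \<longlonglongrightarrow> 1 ^ 8 * 1"
    unfolding D_def
  proof (intro tendsto_intros)
    show "(\<lambda>j. C_coef (Suc j)) \<longlonglongrightarrow> 1" using C_coef_tendsto by (rule LIMSEQ_Suc)
    show "(\<lambda>j. (real j + 1) / (real j + 2)) \<longlonglongrightarrow> 1"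
      using LIMSEQ_Suc[OF LIMSEQ_n_over_Suc_n] by (simp add: add_ac)
  qed
  ultimately have D: "D j \<le> 1" for j using incseq_le[of D 1 j] by simp
  define x where "x = real i"
  have x: "x > 0" using assms by (simp add: x_def)
  obtain j where j: "i = Suc j" using assms by (cases i) auto
  have "C_coef i ^ 8 * (x / (x + 1)) \<le> 1"
    using D[of j] by (simp add: D_def j x_def add_ac)
  then have "C_coef i ^ 8 \<le> (x + 1) / x"
    using x by (simp add: field_simps)
  then have "C_coef i powr 8 \<le> (x + 1) / x"
    using C_coef_pos[of i] by (simp add: powr_numeral)
  then have "(C_coef i powr 8) powr (1 / 8) \<le> ((x + 1) / x) powr (1 / 8)"
    by (intro powr_mono2) auto
  then show ?thesis
    using C_coef_pos[of i] by (simp add: powr_powr x_def del: powr_numeral)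
qed

section \<open>The error function\<close>

lemma has_real_derivative_erf:
  "(erf has_real_derivative 2 / sqrt pi * exp (- u\<^sup>2)) (at u)"
proof -
  define a where "a = \<bar>u\<bar> + 1"
  have "((\<lambda>u. LBINT y=ereal 0..u. exp (- y\<^sup>2)) has_vector_derivative exp (- u\<^sup>2)) (at u within {- a..a})"
    by (rule interval_integral_FTC2) (auto simp: a_def intro!: continuous_intros)
  moreover have "u \<in> interior {- a..a}" by (auto simp: a_def)
  ultimately have "((\<lambda>u. LBINT y=ereal 0..u. exp (- y\<^sup>2)) has_real_derivative exp (- u\<^sup>2)) (at u)"
    unfolding has_real_derivative_iff_has_vector_derivative by (simp only: at_within_interior)
  from DERIV_cmult[OF this, of "2 / sqrt pi"] show ?thesis
    by (simp add: erf_def [abs_def] zero_ereal_def)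
qed

lemmas has_real_derivative_erf' [derivative_intros] =
  DERIV_chain2[OF has_real_derivative_erf]

lemma erf_0 [simp]: "erf 0 = 0"
  by (simp add: erf_def zero_ereal_def)

lemma erf_mono: "x \<le> y \<Longrightarrow> erf x \<le> erf y"
  by (rule DERIV_nonneg_imp_nondecreasing) (auto intro!: exI has_real_derivative_erf)

lemma erf_pos: "x > 0 \<Longrightarrow> erf x > 0"
  using DERIV_pos_imp_increasing[of 0 x erf] has_real_derivative_erf by fastforce

text \<open>For \<open>y \<ge> 0\<close>, \<open>erf y\<close> is the Gaussian integral over the
  positive half-line truncated at \<open>y\<close>, divided by its full value
  \<open>sqrt pi / 2\<close>.\<close>

lemma erf_tendsto_1: "(erf \<longlongrightarrow> 1) at_top"
proof -
  note gauss = gaussian_moment_0[unfolded has_bochner_integral_iff]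
  let ?F = "\<lambda>y. \<integral>x. indicator {..y} x *\<^sub>R (indicator {0..} x *\<^sub>R exp (- x\<^sup>2)) \<partial>lborel :: real"
  have "((\<lambda>y. 2 / sqrt pi * ?F y) \<longlongrightarrow> 2 / sqrt pi * (sqrt pi / 2)) at_top"
    using tendsto_integral_at_top[OF sets_lborel gauss[THEN conjunct1]]
    unfolding gauss[THEN conjunct2] by (intro tendsto_intros)
  moreover have "eventually (\<lambda>y. 2 / sqrt pi * ?F y = erf y) at_top"
    using eventually_ge_at_top[of "0 :: real"]
  proof eventually_elim
    case (elim y)
    have "(LBINT t=ereal 0..ereal y. exp (- t\<^sup>2)) = (LBINT t:{0..y}. exp (- t\<^sup>2))"
      using elim by (rule interval_integral_Icc)
    also have "\<dots> = ?F y"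
      unfolding set_lebesgue_integral_def
      by (intro Bochner_Integration.integral_cong) (auto split: split_indicator)
    finally show ?case by (simp add: erf_def zero_ereal_def)
  qed
  ultimately show ?thesis by (auto dest: Lim_transform_eventually)
qed

section \<open>The polynomial \<open>bias_sum\<close> and its bound by the error function\<close>

definition bias_sum :: "nat \<Rightarrow> real \<Rightarrow> real" where
  "bias_sum i b = b * (\<Sum>j\<le>i. cbin j * (1 - b\<^sup>2) ^ j)"

text \<open>With \<open>u = 1 - b\<^sup>2\<close>, the derivative of \<open>b * u ^ j\<close> is
  \<open>(2 * j + 1) * u ^ j - 2 * j * u ^ (j - 1)\<close>. Weighted with \<open>cbin\<close>, these
  telescope by \<open>cbin_Suc\<close>, and only the top power survives.\<close>

lemma has_real_derivative_bias_sum: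
  "(bias_sum i has_real_derivative (2 * real i + 1) * cbin i * (1 - b\<^sup>2) ^ i) (at b)"
proof (induction i)
  case 0
  show ?case by (auto simp: bias_sum_def [abs_def] intro!: derivative_eq_intros)
next
  case (Suc i)
  define u where "u = 1 - b\<^sup>2"
  have eq: "bias_sum (Suc i) = (\<lambda>b. bias_sum i b + cbin (Suc i) * (b * (1 - b\<^sup>2) ^ Suc i))"
    by (simp add: fun_eq_iff bias_sum_def algebra_simps)
  have "((\<lambda>b. 1 - b\<^sup>2) has_real_derivative - (2 * b)) (at b)"
    by (auto intro!: derivative_eq_intros)
  from DERIV_mult[OF DERIV_ident DERIV_power_Suc[OF this, of i]]
  have "((\<lambda>b. b * (1 - b\<^sup>2) ^ Suc i) has_real_derivative
      u ^ Suc i - 2 * (real i + 1) * b\<^sup>2 * u ^ i) (at b)"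
    by (rule DERIV_cong) (simp add: u_def power2_eq_square algebra_simps)
  also have "u ^ Suc i - 2 * (real i + 1) * b\<^sup>2 * u ^ i =
      (2 * real i + 3) * u ^ Suc i - 2 * (real i + 1) * u ^ i"
    by (simp add: u_def algebra_simps)
  finally have "(bias_sum (Suc i) has_real_derivative (2 * real i + 1) * cbin i * u ^ i +
      cbin (Suc i) * ((2 * real i + 3) * u ^ Suc i - 2 * (real i + 1) * u ^ i)) (at b)"
    unfolding eq using Suc by (intro DERIV_add DERIV_cmult) (simp_all add: u_def)
  also have "(2 * real i + 1) * cbin i * u ^ i +
      cbin (Suc i) * ((2 * real i + 3) * u ^ Suc i - 2 * (real i + 1) * u ^ i) =
      (2 * real (Suc i) + 1) * cbin (Suc i) * u ^ Suc i"
    unfolding cbin_Suc[of i, symmetric] by (simp add: algebra_simps)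
  finally show ?case by (simp add: u_def)
qed

text \<open>Each power in the sum is at least the last one, and \<open>sum_cbin\<close> adds up the
  coefficients. The bound controls a derivative in \<open>bias_sum_le_erf\<close>.\<close>

lemma bias_sum_ge:
  assumes "0 \<le> b" "b \<le> 1"
  shows "b * (1 - b\<^sup>2) ^ i * ((2 * real i + 1) * cbin i) \<le> bias_sum i b"
proof -
  have "b\<^sup>2 \<le> 1" using assms by (simp add: power_le_one)
  then have "(\<Sum>j\<le>i. cbin j * (1 - b\<^sup>2) ^ i) \<le> (\<Sum>j\<le>i. cbin j * (1 - b\<^sup>2) ^ j)"
    using cbin_pos by (intro sum_mono mult_left_mono power_decreasing) (auto intro: less_imp_le)
  then have "b * (\<Sum>j\<le>i. cbin j * (1 - b\<^sup>2) ^ i) \<le> bias_sum i b"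
    unfolding bias_sum_def using assms by (intro mult_left_mono) auto
  then show ?thesis
    by (simp add: sum_distrib_right[symmetric] sum_cbin mult_ac)
qed

text \<open>The difference of the two sides, multiplied by \<open>exp (- b\<^sup>2 / 6)\<close>, is
  \<open>G\<close>; it vanishes at 0 and increases. The constant 1/6 balances the exponents: after
  damping by \<open>exp (- a * t\<^sup>2)\<close>, the derivative of the \<open>bias_sum\<close>
  part is at most \<open>K * exp (- (i + 3 * a) * t\<^sup>2)\<close>, and \<open>a = 1 / 6\<close>
  turns \<open>i + 3 * a\<close> into \<open>i + 1 / 2\<close>.\<close>

lemma bias_sum_le_erf:
  assumes "0 \<le> b" "b \<le> 1"
  shows "bias_sum i b \<le> C_coef i * erf (b * sqrt (real i + 1 / 2)) * exp (b\<^sup>2 / 6)"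
proof -
  define n where "n = real i + 1 / 2"
  have n: "n > 0" by (simp add: n_def add_nonneg_pos)
  define K where "K = (2 * real i + 1) * cbin i"
  have K: "K > 0" using cbin_pos[of i] by (simp add: K_def add_nonneg_pos)
  \<comment> \<open>So the derivative of \<open>C_coef i * erf (t * sqrt n)\<close> carries the same
    factor \<open>K\<close> as that of \<open>bias_sum i\<close>.\<close>
  have CK: "C_coef i * (2 / sqrt pi * (sqrt n * x)) = K * x" for x
  proof -
    have "C_coef i * (2 / sqrt pi * (sqrt n * x)) = 2 * (sqrt n * sqrt n) * cbin i * x"
      by (simp add: C_coef_eq n_def[symmetric] real_sqrt_mult)
    also have "sqrt n * sqrt n = n" using n by simp
    finally show ?thesis by (simp add: K_def n_def algebra_simps)
  qed
  define G where "G t = C_coef i * erf (t * sqrt n) - bias_sum i t * exp (- t\<^sup>2 / 6)" for t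
  have "G 0 \<le> G b"
  proof (rule DERIV_nonneg_imp_nondecreasing[where f = G])
    fix t assume t: "0 \<le> t" "t \<le> b"
    then have "t \<le> 1" using assms by simp
    have t2: "t\<^sup>2 \<le> 1" using t \<open>t \<le> 1\<close> by (simp add: power_le_one)
    let ?D = "K * exp (- (t * sqrt n)\<^sup>2) -
      (K * (1 - t\<^sup>2) ^ i - t / 3 * bias_sum i t) * exp (- t\<^sup>2 / 6)"
    let ?D' = "C_coef i * (2 / sqrt pi * exp (- (t * sqrt n)\<^sup>2) * sqrt n) -
      (K * (1 - t\<^sup>2) ^ i * exp (- t\<^sup>2 / 6) + bias_sum i t * (exp (- t\<^sup>2 / 6) * (- (t / 3))))"
    have "(G has_real_derivative ?D') (at t)"
      unfolding G_def K_def
      by (auto intro!: derivative_eq_intros has_real_derivative_bias_sum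
          simp: mult.commute mult.left_commute)
    moreover have "?D' = ?D"
      using CK[of "exp (- (t * sqrt n)\<^sup>2)"] by (simp add: algebra_simps)
    ultimately have "(G has_real_derivative ?D) (at t)"
      by simp
    moreover have "(K * (1 - t\<^sup>2) ^ i - t / 3 * bias_sum i t) * exp (- t\<^sup>2 / 6)
        \<le> K * exp (- (t * sqrt n)\<^sup>2)"
    proof -
      have "t / 3 * bias_sum i t \<ge> t / 3 * (t * (1 - t\<^sup>2) ^ i * K)"
        using bias_sum_ge[OF t(1) \<open>t \<le> 1\<close>, of i] t by (intro mult_left_mono) (auto simp: K_def)
      then have "K * (1 - t\<^sup>2) ^ i - t / 3 * bias_sum i t \<le> K * ((1 - t\<^sup>2) ^ i * (1 - t\<^sup>2 / 3))"
        by (simp add: power2_eq_square algebra_simps)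
      also have "\<dots> \<le> K * (exp (- t\<^sup>2) ^ i * exp (- t\<^sup>2 / 3))"
        using K t2 exp_ge_add_one_self[of "- t\<^sup>2"] exp_ge_add_one_self[of "- t\<^sup>2 / 3"]
        by (intro mult_left_mono mult_mono power_mono) auto
      also have "\<dots> = K * (exp (- (t * sqrt n)\<^sup>2) * exp (t\<^sup>2 / 6))"
        using n by (simp add: exp_of_nat_mult[symmetric] exp_add[symmetric] power_mult_distrib n_def algebra_simps)
      finally show ?thesis
        by (simp add: exp_minus field_simps)
    qed
    ultimately show "\<exists>y. (G has_real_derivative y) (at t) \<and> 0 \<le> y" by (intro exI[of _ ?D]) auto
  qed (use assms in auto)
  then have "bias_sum i b * exp (- b\<^sup>2 / 6) \<le> C_coef i * erf (b * sqrt n)"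
    by (simp add: G_def bias_sum_def)
  then show ?thesis by (simp add: n_def exp_minus field_simps)
qed

text \<open>The derivative of \<open>erf (b * sqrt x)\<close> in \<open>x\<close> is a product of
  two nonnegative, nonincreasing functions. At 0 the square root is not differentiable, hence the
  open half-line.\<close>

lemma convex_on_neg_erf_sqrt:
  assumes "b \<ge> 0"
  shows "convex_on {0<..} (\<lambda>x. - erf (b * sqrt x))"
proof (rule convex_on_realI)
  fix x :: real assume "x \<in> {0<..}"
  then show "((\<lambda>x. - erf (b * sqrt x)) has_real_derivative
      - (2 / sqrt pi * exp (- (b * sqrt x)\<^sup>2) * (b * (inverse (sqrt x) / 2)))) (at x)"
    by (auto intro!: derivative_eq_intros)
next
  fix x y :: real assume xy: "x \<in> {0<..}" "y \<in> {0<..}" "x \<le> y"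
  have "b * sqrt x \<le> b * sqrt y" using xy assms by (intro mult_left_mono) auto
  then have "(b * sqrt x)\<^sup>2 \<le> (b * sqrt y)\<^sup>2" using assms xy by (intro power_mono) auto
  then have "2 / sqrt pi * exp (- (b * sqrt y)\<^sup>2) * (b * (inverse (sqrt y) / 2))
      \<le> 2 / sqrt pi * exp (- (b * sqrt x)\<^sup>2) * (b * (inverse (sqrt x) / 2))"
    using xy assms by (intro mult_mono mult_left_mono divide_right_mono le_imp_inverse_le) auto
  then show "- (2 / sqrt pi * exp (- (b * sqrt x)\<^sup>2) * (b * (inverse (sqrt x) / 2)))
      \<le> - (2 / sqrt pi * exp (- (b * sqrt y)\<^sup>2) * (b * (inverse (sqrt y) / 2)))" by simp
qed (auto simp: is_interval_connected)

lemma interpolated_bias_sum_le_erf: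
  assumes b: "0 \<le> b" "b \<le> 1" and \<nu>: "2 * real i + 1 \<le> \<nu>" "\<nu> \<le> 2 * real i + 3"
  shows "(2 * real i + 3 - \<nu>) / 2 * bias_sum i b + (\<nu> - 2 * real i - 1) / 2 * bias_sum (Suc i) b
    \<le> C_coef i * erf (b * sqrt (\<nu> / 2)) * exp (b\<^sup>2 / 6)"
proof -
  define t where "t = (\<nu> - 2 * real i - 1) / 2"
  have t: "0 \<le> t" "t \<le> 1" and t1: "1 - t = (2 * real i + 3 - \<nu>) / 2"
    using \<nu> by (simp_all add: t_def field_simps)
  let ?e = "\<lambda>x. erf (b * sqrt x)"
  have "bias_sum (Suc i) b \<le> C_coef (Suc i) * ?e (real i + 3 / 2) * exp (b\<^sup>2 / 6)"
    using bias_sum_le_erf[OF b, of "Suc i"] by (simp add: add_ac)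
  also have "\<dots> \<le> C_coef i * ?e (real i + 3 / 2) * exp (b\<^sup>2 / 6)"
    using decseq_SucD[OF decseq_C_coef, of i] erf_mono[of 0 "b * sqrt (real i + 3 / 2)"] b
    by (intro mult_right_mono) auto
  finally have "t * bias_sum (Suc i) b \<le> t * (C_coef i * ?e (real i + 3 / 2) * exp (b\<^sup>2 / 6))"
    using t by (intro mult_left_mono)
  moreover have "(1 - t) * bias_sum i b \<le> (1 - t) * (C_coef i * ?e (real i + 1 / 2) * exp (b\<^sup>2 / 6))"
    using t bias_sum_le_erf[OF b, of i] by (intro mult_left_mono) auto
  ultimately have "(1 - t) * bias_sum i b + t * bias_sum (Suc i) b
      \<le> C_coef i * exp (b\<^sup>2 / 6) * ((1 - t) * ?e (real i + 1 / 2) + t * ?e (real i + 3 / 2))"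
    by (simp add: algebra_simps)
  \<comment> \<open>Concavity: the arguments are half the nodes \<open>2 * i + 1\<close> and
    \<open>2 * i + 3\<close>, and their weighted mean is half of \<open>\<nu>\<close>.\<close>
  also have "(1 - t) * ?e (real i + 1 / 2) + t * ?e (real i + 3 / 2)
      \<le> ?e ((1 - t) * (real i + 1 / 2) + t * (real i + 3 / 2))"
    using convex_onD[OF convex_on_neg_erf_sqrt[OF b(1)] t, of "real i + 1 / 2" "real i + 3 / 2"]
    by (simp add: add_nonneg_pos)
  also have "(1 - t) * (real i + 1 / 2) + t * (real i + 3 / 2) = \<nu> / 2"
    by (simp add: t_def field_simps)
  finally show ?thesis
    using C_coef_pos[of i] unfolding t1 by (simp add: t_def mult_ac)
qed

section \<open>The maximizer \<open>z_*\<close>\<close>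

definition normal_tail :: "real \<Rightarrow> real" where
  "normal_tail z = (1 - erf (z / sqrt 2)) / 2"

lemma z_objective_eq: "z_objective z = z * normal_tail z"
  by (simp add: z_objective_def normal_tail_def)

lemma has_real_derivative_std_normal_density:
  "(std_normal_density has_real_derivative - (z * std_normal_density z)) (at z)"
proof -
  have "((\<lambda>z. exp (- z\<^sup>2 / 2)) has_real_derivative - (z * exp (- z\<^sup>2 / 2))) (at z)"
    by (auto intro!: derivative_eq_intros)
  from DERIV_cmult[OF this, of "1 / sqrt (2 * pi)"] show ?thesis
    by (simp add: std_normal_density_def [abs_def] mult_ac)
qed

lemma has_real_derivative_normal_tail:
  "(normal_tail has_real_derivative - std_normal_density z) (at z)"
  unfolding normal_tail_def [abs_def] std_normal_density_def
  by (auto intro!: derivative_eq_intros simp: power_divide real_sqrt_mult divide_simps)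

lemma has_real_derivative_z_objective:
  "(z_objective has_real_derivative normal_tail z - z * std_normal_density z) (at z)"
proof -
  have eq: "z_objective = (\<lambda>z. z * normal_tail z)" by (simp add: fun_eq_iff z_objective_eq)
  show ?thesis unfolding eq
    by (auto intro!: derivative_eq_intros has_real_derivative_normal_tail)
qed

lemma normal_tail_tendsto_0: "(normal_tail \<longlongrightarrow> 0) at_top"
proof -
  have "filterlim (\<lambda>z :: real. z / sqrt 2) at_top at_top"
    using filterlim_tendsto_pos_mult_at_top[of "\<lambda>_. 1 / sqrt 2" "1 / sqrt 2" at_top "\<lambda>z. z"]
    by (simp add: filterlim_ident)
  then have "((\<lambda>z. erf (z / sqrt 2)) \<longlongrightarrow> 1) at_top"
    by (rule filterlim_compose[OF erf_tendsto_1])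
  then have "((\<lambda>z. (1 - erf (z / sqrt 2)) / 2) \<longlongrightarrow> (1 - 1) / 2) at_top"
    by (intro tendsto_intros) auto
  then show ?thesis by (simp add: normal_tail_def [abs_def])
qed

lemma std_normal_density_over_id_tendsto_0:
  "((\<lambda>z. std_normal_density z / z) \<longlongrightarrow> 0) at_top"
proof (rule tendsto_sandwich[where f = "\<lambda>_. 0" and h = "\<lambda>z. 1 / z"])
  show "((\<lambda>z::real. 1 / z) \<longlongrightarrow> 0) at_top"
    using tendsto_inverse_0_at_top[OF filterlim_ident] by (simp add: inverse_eq_divide)
  show "eventually (\<lambda>z. 0 \<le> std_normal_density z / z) at_top"
    using eventually_gt_at_top[of "0 :: real"] by eventually_elim simp
  show "eventually (\<lambda>z. std_normal_density z / z \<le> 1 / z) at_top"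
    using eventually_gt_at_top[of "0 :: real"]
  proof eventually_elim
    case (elim z)
    have "1 \<le> sqrt (2 * pi)" using pi_ge_two by simp
    then have "std_normal_density z \<le> 1"
      unfolding std_normal_density_def using mult_mono[of "1 / sqrt (2 * pi)" 1 "exp (- z\<^sup>2 / 2)" 1] by simp
    then show ?case using elim by (simp add: divide_right_mono)
  qed
qed simp

text \<open>The right-hand side minus the left-hand side has derivative
  \<open>- std_normal_density x / x\<^sup>2 < 0\<close> and tends to 0 at infinity, so it is
  positive before.\<close>

lemma normal_tail_less_mills:
  assumes "z > 0"
  shows "normal_tail z < std_normal_density z / z"
proof -
  have "0 < std_normal_density z / z - normal_tail z"
  proof (rule DERIV_neg_imp_decreasing_at_top[where f = "\<lambda>z. std_normal_density z / z - normal_tail z"])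
    fix x :: real assume "x \<ge> z"
    then have x: "x > 0" using assms by simp
    have "((\<lambda>z. std_normal_density z / z - normal_tail z) has_real_derivative
        - std_normal_density x / x\<^sup>2) (at x)"
      using x by (auto intro!: derivative_eq_intros has_real_derivative_std_normal_density
          has_real_derivative_normal_tail simp: power2_eq_square field_simps)
    moreover have "- std_normal_density x / x\<^sup>2 < 0"
      using x normal_density_pos[of 1 0 x] by (simp add: divide_neg_pos)
    ultimately show "\<exists>y. ((\<lambda>z. std_normal_density z / z - normal_tail z) has_real_derivative y) (at x) \<and> y < 0"
      by blast
  next
    show "((\<lambda>z. std_normal_density z / z - normal_tail z) \<longlongrightarrow> 0) at_top"
      using tendsto_diff[OF std_normal_density_over_id_tendsto_0 normal_tail_tendsto_0] by simp
  qed
  then show ?thesis by simp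
qed

text \<open>The derivative \<open>G\<close> of \<open>z_objective\<close> decreases on
  \<open>[0, 1]\<close>, as \<open>z\<^sup>2 < 2\<close> there, and is negative from 1 on by Mills'
  inequality. Hence its zero in \<open>(0, 1)\<close> is the unique maximizer, which also makes the
  definite description in \<open>z_star\<close> meaningful.\<close>

lemma z_star_bounds: "0 < z_star" "z_star < 1"
proof -
  define G where "G z = normal_tail z - z * std_normal_density z" for z
  have dens_pos: "std_normal_density z > 0" for z
    by (rule normal_density_pos) simp
  have obj: "(z_objective has_real_derivative G z) (at z)" for z
    using has_real_derivative_z_objective by (simp add: G_def)
  have G': "(G has_real_derivative std_normal_density z * (z\<^sup>2 - 2)) (at z)" for z
    unfolding G_def [abs_def]
    by (auto intro!: derivative_eq_intros has_real_derivative_std_normal_density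
          has_real_derivative_normal_tail simp: power2_eq_square algebra_simps)
  have G_decr: "G y < G x" if "0 \<le> x" "x < y" "y \<le> 1" for x y
  proof (rule DERIV_neg_imp_decreasing[OF that(2)])
    fix t assume "x \<le> t" "t \<le> y"
    then have "t\<^sup>2 \<le> 1" using that by (simp add: power_le_one)
    then show "\<exists>d. (G has_real_derivative d) (at t) \<and> d < 0"
      using G'[of t] dens_pos[of t] by (intro exI[of _ "std_normal_density t * (t\<^sup>2 - 2)"]) (auto simp: mult_pos_neg)
  qed
  have G_neg: "G z < 0" if "z \<ge> 1" for z
  proof -
    have "std_normal_density z / z \<le> std_normal_density z" "std_normal_density z \<le> z * std_normal_density z"
      using that dens_pos[of z] by (simp_all add: divide_le_eq)
    then show ?thesis using normal_tail_less_mills[of z] that by (simp add: G_def)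
  qed
  have "G 0 > 0" by (simp add: G_def normal_tail_def)
  moreover have "continuous_on {0..1} G"
    by (rule DERIV_continuous_on) (use G' has_field_derivative_at_within in blast)
  ultimately obtain z where z: "0 \<le> z" "z \<le> 1" "G z = 0"
    using IVT2'[of G 1 0 0] G_neg[of 1] by auto
  with \<open>G 0 > 0\<close> G_neg[of 1] have z01: "0 < z" "z < 1" by (auto simp: less_le)
  have max: "z_objective w < z_objective z" if "w > 0" "w \<noteq> z" for w
  proof (cases "w < z")
    case True
    show ?thesis
    proof (rule DERIV_pos_imp_increasing_open[OF True])
      fix x assume "w < x" "x < z"
      then have "G x > 0" using G_decr[of x z] z z01 that by simp
      then show "\<exists>y. (z_objective has_real_derivative y) (at x) \<and> y > 0" using obj by blast
    qed (rule DERIV_continuous_on, use obj has_field_derivative_at_within in blast)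
  next
    case False
    then have "z < w" using that by simp
    then show ?thesis
    proof (rule DERIV_neg_imp_decreasing_open)
      fix x assume "z < x" "x < w"
      then have "G x < 0" using G_decr[of z x] z z01 G_neg[of x] by (cases "x \<le> 1") auto
      then show "\<exists>y. (z_objective has_real_derivative y) (at x) \<and> y < 0" using obj by blast
    qed (rule DERIV_continuous_on, use obj has_field_derivative_at_within in blast)
  qed
  have "z_star = z"
    unfolding z_star_def
  proof (rule the_equality)
    show "0 < z \<and> (\<forall>w>0. z_objective w \<le> z_objective z)"
      using z01 max by (metis less_imp_le order_refl)
    show "y = z" if "0 < y \<and> (\<forall>w>0. z_objective w \<le> z_objective y)" for y
      using that max[of y] z01 by force
  qed
  then show "0 < z_star" "z_star < 1" using z01 by simp_all
qed

text \<open>Both corrections, the factor \<open>C_coef (idx \<nu>) \<ge> 1\<close> and the division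
  by an exponential below 1, enlarge the subtracted term.\<close>

lemma c_nu_less_c_inf:
  assumes "\<nu> > 0"
  shows "c_nu \<nu> < c_inf"
proof -
  have E: "erf (z_star / sqrt 2) > 0" using z_star_bounds by (intro erf_pos) simp
  have "exp (- (z_star\<^sup>2 / (6 * \<nu>))) < 1" using z_star_bounds assms by simp
  then have "erf (z_star / sqrt 2) < erf (z_star / sqrt 2) / exp (- (z_star\<^sup>2 / (6 * \<nu>)))"
    using E by (simp add: less_divide_eq)
  also have "\<dots> \<le> C_coef (idx \<nu>) * (erf (z_star / sqrt 2) / exp (- (z_star\<^sup>2 / (6 * \<nu>))))"
    using E mult_right_mono[OF C_coef_ge_1[of "idx \<nu>"],
        of "erf (z_star / sqrt 2) / exp (- (z_star\<^sup>2 / (6 * \<nu>)))"] by simp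
  finally show ?thesis
    unfolding c_nu_def c_inf_def z_objective_def using z_star_bounds
    by (intro mult_strict_left_mono) auto
qed

lemma c_tilde_le_c_nu:
  assumes "\<nu> \<ge> 3"
  shows "c_tilde \<nu> \<le> c_nu \<nu>"
proof -
  have E: "erf (z_star / sqrt 2) > 0" using z_star_bounds by (intro erf_pos) simp
  have "idx \<nu> \<ge> 1" using assms unfolding idx_def by (simp add: le_nat_iff le_floor_iff)
  from C_coef_le_powr[OF this] show ?thesis
    unfolding c_nu_def c_tilde_def using z_star_bounds E
    by (intro mult_left_mono diff_left_mono mult_right_mono) auto
qed

section \<open>Biased random walks and the Bayes error\<close>

text \<open>Over a finite support the iterated expectation is a finite sum, so \<open>f\<close>
  needs no integrability assumption.\<close>

lemma expectation_replicate_pmf_Suc: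
  fixes f :: "'a list \<Rightarrow> real"
  assumes "finite (set_pmf p)"
  shows "measure_pmf.expectation (replicate_pmf (Suc n) p) f =
    measure_pmf.expectation p (\<lambda>x. measure_pmf.expectation (replicate_pmf n p) (\<lambda>xs. f (x # xs)))"
proof -
  have "set_pmf (replicate_pmf n p) = {xs. set xs \<subseteq> set_pmf p \<and> length xs = n}"
    by (auto simp: set_replicate_pmf)
  then have fin: "finite (set_pmf (replicate_pmf n p))"
    using finite_lists_length_eq[OF assms, of n] by simp
  have eq: "replicate_pmf (Suc n) p = p \<bind> (\<lambda>x. map_pmf (Cons x) (replicate_pmf n p))"
    by (simp add: map_pmf_def)
  have "measure_pmf.expectation (replicate_pmf (Suc n) p) f =
      (\<Sum>x\<in>set_pmf p. pmf p x *\<^sub>R measure_pmf.expectation (map_pmf (Cons x) (replicate_pmf n p)) f)"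
    unfolding eq using assms fin by (intro pmf_expectation_bind) auto
  also have "\<dots> = (\<Sum>x\<in>set_pmf p. pmf p x *\<^sub>R
      measure_pmf.expectation (replicate_pmf n p) (\<lambda>xs. f (x # xs)))"
    by simp
  also have "\<dots> = measure_pmf.expectation p (\<lambda>x. measure_pmf.expectation (replicate_pmf n p) (\<lambda>xs. f (x # xs)))"
    using assms by (intro integral_measure_pmf[symmetric]) auto
  finally show ?thesis .
qed

lemma expectation_Y_pmf:
  fixes f :: "int \<Rightarrow> real"
  assumes "\<bar>b\<bar> \<le> 1"
  shows "measure_pmf.expectation (Y_pmf b) f = (1 + b) / 2 * f 1 + (1 - b) / 2 * f (- 1)"
  using assms by (simp add: Y_pmf_def) (simp add: field_simps)

lemma finite_set_Y_pmf: "finite (set_pmf (Y_pmf b))"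
  by (simp add: Y_pmf_def)

text \<open>For \<open>\<bar>b\<bar> \<le> 1\<close>, the expectation of \<open>f\<close> at the
  place reached from \<open>v\<close> after \<open>k\<close> steps with drift \<open>b\<close>. The
  recursion on the first step lets inductions replace measure theory.\<close>

primrec walk :: "real \<Rightarrow> nat \<Rightarrow> (int \<Rightarrow> real) \<Rightarrow> int \<Rightarrow> real" where
  "walk b 0 f v = f v"
| "walk b (Suc k) f v = (1 + b) / 2 * walk b k f (v + 1) + (1 - b) / 2 * walk b k f (v - 1)"

lemma expectation_replicate_Y_pmf:
  assumes "\<bar>b\<bar> \<le> 1"
  shows "measure_pmf.expectation (replicate_pmf k (Y_pmf b)) (\<lambda>ys. f (v + sum_list ys)) = walk b k f v"
proof (induction k arbitrary: v)
  case (Suc k)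
  have "(\<lambda>ys. f (v + (y + sum_list ys))) = (\<lambda>ys. f ((v + y) + sum_list ys))" for y
    by (simp add: add_ac)
  with Suc show ?case
    by (simp add: expectation_replicate_pmf_Suc[OF finite_set_Y_pmf] expectation_Y_pmf[OF assms]
        del: replicate_pmf.simps(2))
qed simp

lemma prob_V_pmf:
  assumes "\<bar>b\<bar> \<le> 1"
  shows "measure_pmf.prob (V_pmf k b) {v. v > 0} = walk b k (\<lambda>v. if v > 0 then 1 else 0) 0"
proof -
  have "measure_pmf.prob (V_pmf k b) {v. v > 0} =
      measure_pmf.expectation (V_pmf k b) (\<lambda>v. if v > 0 then 1 else 0)"
    by (subst Bochner_Integration.integral_cong[OF refl, where g = "indicat_real {v. v > 0}"])
      (auto simp: indicator_def)
  also have "\<dots> = measure_pmf.expectation (replicate_pmf k (Y_pmf b))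
      (\<lambda>ys. (\<lambda>v. if v > 0 then 1 else 0) (0 + sum_list ys))"
    by (simp add: V_pmf_def)
  also have "\<dots> = walk b k (\<lambda>v. if v > 0 then 1 else 0) 0"
    by (rule expectation_replicate_Y_pmf[OF assms])
  finally show ?thesis .
qed

lemma walk_add: "walk b k (\<lambda>v. f v + g v) v = walk b k f v + walk b k g v"
  by (induction k arbitrary: v) (simp_all add: algebra_simps)

lemma walk_cmult: "walk b k (\<lambda>v. c * f v) v = c * walk b k f v"
  by (induction k arbitrary: v) (simp_all add: algebra_simps)

lemma walk_diff: "walk b k (\<lambda>v. f v - g v) v = walk b k f v - walk b k g v"
  using walk_add[of b k f "\<lambda>v. - 1 * g v" v] unfolding walk_cmult by simp

lemma walk_one: "walk b k (\<lambda>v. 1) v = 1"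
  by (induction k arbitrary: v) (simp_all add: field_simps)

lemma walk_mono:
  assumes "\<bar>b\<bar> \<le> 1" "\<And>v. f v \<le> g v"
  shows "walk b k f v \<le> walk b k g v"
proof (induction k arbitrary: v)
  case (Suc k)
  then show ?case using assms(1) by (auto intro!: add_mono mult_left_mono)
qed (use assms in simp)

text \<open>Conditions on the last step instead of the first, as \<open>bayes_Suc\<close>
  requires.\<close>

lemma walk_Suc_final:
  "walk b (Suc k) f v = walk b k (\<lambda>v. (1 + b) / 2 * f (v + 1) + (1 - b) / 2 * f (v - 1)) v"
proof (induction k arbitrary: v)
  case (Suc k)
  have "walk b (Suc (Suc k)) f v =
      (1 + b) / 2 * walk b (Suc k) f (v + 1) + (1 - b) / 2 * walk b (Suc k) f (v - 1)"
    by (rule walk.simps(2))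
  then show ?case by (simp only: Suc walk.simps(2)[of b k _ v])
qed simp

lemma ratio_simps:
  assumes "0 < b" "b < 1"
  shows "(1 + b) / 2 * ((1 - b) / (1 + b)) = (1 - b) / (2 :: real)"
    and "(1 - b) / 2 / ((1 - b) / (1 + b)) = (1 + b) / (2 :: real)"
proof -
  have gen: "x / 2 * (y / x) = y / 2" "y / 2 / (y / x) = x / 2" if "x \<noteq> 0" "y \<noteq> 0" for x y :: real
    using that by simp_all
  show "(1 + b) / 2 * ((1 - b) / (1 + b)) = (1 - b) / (2 :: real)"
    using assms by (intro gen) auto
  show "(1 - b) / 2 / ((1 - b) / (1 + b)) = (1 + b) / (2 :: real)"
    using assms by (intro gen) auto
qed

text \<open>Change of measure: \<open>r\<close> turns the weight of a step up into that of a step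
  down, and \<open>1 / r\<close> does the converse. So \<open>r\<close> to the power of the
  displacement is the likelihood ratio of drift \<open>- b\<close> against drift
  \<open>b\<close>.\<close>

lemma walk_tilt:
  assumes "0 < b" "b < 1"
  defines "r \<equiv> (1 - b) / (1 + b)"
  shows "walk b k (\<lambda>v. r powi v * g v) v = r powi v * walk (- b) k g v"
proof (induction k arbitrary: v)
  case (Suc k)
  have r: "r \<noteq> 0" using assms by (simp add: r_def)
  have powi: "r powi (v + 1) = r powi v * r" "r powi (v - 1) = r powi v / r"
    using r by (simp_all add: power_int_add power_int_diff)
  have "walk b (Suc k) (\<lambda>v. r powi v * g v) v =
      (1 + b) / 2 * (r powi v * r * walk (- b) k g (v + 1)) +
      (1 - b) / 2 * (r powi v / r * walk (- b) k g (v - 1))"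
    by (simp only: walk.simps(2) Suc powi)
  also have "\<dots> = r powi v *
      (((1 + b) / 2 * r) * walk (- b) k g (v + 1) + ((1 - b) / 2 / r) * walk (- b) k g (v - 1))"
    by (simp add: algebra_simps)
  finally show ?case unfolding r_def ratio_simps[OF assms(1,2)] by simp
qed simp

section \<open>Return probabilities of the walk\<close>

lemma walk_return_parity:
  assumes "odd (v + int k)"
  shows "walk b k (\<lambda>v. if v = 0 then 1 else 0) v = 0"
  using assms by (induction k arbitrary: v) auto

lemma walk_return_far:
  assumes "v > int k"
  shows "walk b k (\<lambda>v. if v = 0 then 1 else 0) v = 0"
  using assms by (induction k arbitrary: v) auto

text \<open>From \<open>k - 2 * x\<close> the walk is at 0 after \<open>k\<close> steps exactly when
  \<open>x\<close> of them go up.\<close>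

lemma walk_return:
  "walk b k (\<lambda>v. if v = 0 then 1 else 0) (int k - 2 * int x) =
    real (k choose x) * ((1 + b) / 2) ^ x * ((1 - b) / 2) ^ (k - x)"
proof (induction k arbitrary: x)
  case 0
  then show ?case by (cases x) auto
next
  case (Suc k)
  define p q where "p = (1 + b) / 2" and "q = (1 - b) / 2"
  let ?w = "walk b k (\<lambda>v. if v = 0 then 1 else 0)"
  show ?case
  proof (cases x)
    case 0
    then show ?thesis
      using walk_return_far[of k "int k + 2" b] Suc[of 0] by (simp add: add_ac)
  next
    case (Suc y)
    have "walk b (Suc k) (\<lambda>v. if v = 0 then 1 else 0) (int (Suc k) - 2 * int x) =
        p * ?w (int k - 2 * int y) + q * ?w (int k - 2 * int x)"
      by (simp add: Suc p_def q_def algebra_simps)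
    also have "\<dots> = p * (real (k choose y) * p ^ y * q ^ (k - y)) +
        q * (real (k choose x) * p ^ x * q ^ (k - x))"
      by (simp add: Suc.IH p_def q_def)
    also have "\<dots> = real (Suc k choose x) * p ^ x * q ^ (Suc k - x)"
    proof (cases "x \<le> k")
      case True
      then have "k - y = Suc (k - x)" "Suc k - x = Suc (k - x)" using Suc by auto
      then show ?thesis using Suc by (simp add: algebra_simps)
    qed (use Suc in \<open>simp add: not_le binomial_eq_0 algebra_simps\<close>)
    finally show ?thesis by (simp add: p_def q_def)
  qed
qed

lemma walk_return_even:
  "walk b (2 * j) (\<lambda>v. if v = 0 then 1 else 0) 0 = cbin j * (1 - b\<^sup>2) ^ j"
proof -
  have "walk b (2 * j) (\<lambda>v. if v = 0 then 1 else 0) 0 =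
      real ((2 * j) choose j) * (((1 + b) / 2) * ((1 - b) / 2)) ^ j"
    unfolding power_mult_distrib using walk_return[of b "2 * j" j] by simp
  also have "((1 + b) / 2) * ((1 - b) / 2) = (1 - b\<^sup>2) / 4"
    by (simp add: power2_eq_square field_simps)
  finally show ?thesis by (simp add: cbin_def power_divide)
qed

text \<open>The smaller of the likelihoods under two opposite labels, relative to the first, when
  the labels seen, signed by the first, add up to \<open>v\<close>.\<close>

definition min_ratio :: "real \<Rightarrow> int \<Rightarrow> real" where
  "min_ratio b v = min 1 (((1 - b) / (1 + b)) powi v)"

lemma min_ratio_eq:
  assumes "0 < b" "b < 1"
  shows "min_ratio b v = (if v > 0 then ((1 - b) / (1 + b)) powi v else 1)"
proof -
  define r where "r = (1 - b) / (1 + b)"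
  have r: "0 < r" "r < 1" using assms by (auto simp: r_def)
  show ?thesis
    using power_int_decreasing[of 0 v r] power_int_decreasing[of v 0 r] r
    by (cases "v > 0") (simp_all add: min_ratio_def r_def[symmetric])
qed

text \<open>Splitting \<open>min_ratio\<close> at \<open>v > 0\<close> gives the probability of
  \<open>V \<le> 0\<close> under drift \<open>b\<close> plus, by \<open>walk_tilt\<close>, that of
  \<open>V > 0\<close> under drift \<open>- b\<close>.\<close>

lemma bayes_eq_walk:
  assumes b: "0 < b" "b < 1"
  shows "bayes k b = walk b k (min_ratio b) 0 / 2"
proof -
  define r where "r = (1 - b) / (1 + b)"
  define pos :: "int \<Rightarrow> real" where "pos = (\<lambda>v. if v > 0 then 1 else 0)"
  have "min_ratio b = (\<lambda>v. (1 - pos v) + r powi v * pos v)"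
    using min_ratio_eq[OF b] by (auto simp: pos_def r_def)
  then have w: "walk b k (min_ratio b) 0 = 1 - walk b k pos 0 + walk (- b) k pos 0"
    using walk_tilt[OF b, of k pos 0] by (simp add: walk_add walk_diff walk_one r_def)
  \<comment> \<open>This settles the sign inside the absolute value of \<open>s_gap\<close>.\<close>
  have "walk b k (min_ratio b) 0 \<le> walk b k (\<lambda>v. 1) 0"
    using b by (intro walk_mono) (auto simp: min_ratio_def)
  then have "walk b k (min_ratio b) 0 \<le> 1" by (simp add: walk_one)
  then show ?thesis
    using prob_V_pmf[of b k] prob_V_pmf[of "- b" k] b
    by (simp add: bayes_def s_gap_def w pos_def)
qed

lemma bayes_0:
  assumes "0 < b" "b < 1"
  shows "bayes 0 b = 1 / 2"
  by (simp add: bayes_eq_walk[OF assms] min_ratio_def)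

text \<open>\<open>min_ratio b v\<close> is 1 for \<open>v \<le> 0\<close> and
  \<open>r powi v\<close> for \<open>v \<ge> 0\<close>, and both functions are invariant under
  averaging over a step. Only at the kink \<open>v = 0\<close> does the average fall, by
  \<open>b\<close>.\<close>

lemma bayes_Suc:
  assumes b: "0 < b" "b < 1"
  shows "bayes (Suc k) b = bayes k b - b / 2 * walk b k (\<lambda>v. if v = 0 then 1 else 0) 0"
proof -
  define r where "r = (1 - b) / (1 + b)"
  have r: "r \<noteq> 0" using b by (simp add: r_def)
  have "(1 + b) / 2 * min_ratio b (v + 1) + (1 - b) / 2 * min_ratio b (v - 1) =
      min_ratio b v - b * (if v = 0 then 1 else 0)" for v
  proof -
    consider "v < 0" | "v = 0" | "v > 0" by linarith
    then show ?thesis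
    proof cases
      case 1
      then show ?thesis using b by (simp add: min_ratio_eq field_simps)
    next
      case 2
      then show ?thesis using b by (simp add: min_ratio_eq field_simps)
    next
      case 3
      have "r powi (v + 1) = r powi v * r" "r powi (v - 1) = r powi v / r"
        using r by (simp_all add: power_int_add power_int_diff)
      moreover have "min_ratio b (v - 1) = r powi (v - 1)"
        using 3 b by (cases "v = 1") (simp_all add: min_ratio_eq r_def)
      ultimately have "(1 + b) / 2 * min_ratio b (v + 1) + (1 - b) / 2 * min_ratio b (v - 1) =
          ((1 + b) / 2 * r + (1 - b) / 2 / r) * r powi v"
        using 3 b by (simp add: min_ratio_eq r_def[symmetric] algebra_simps)
      also have "(1 + b) / 2 * r + (1 - b) / 2 / r = 1"
        unfolding r_def ratio_simps[OF b] by (simp add: field_simps)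
      finally show ?thesis using 3 b by (simp add: min_ratio_eq r_def)
    qed
  qed
  then show ?thesis
    unfolding bayes_eq_walk[OF b] walk_Suc_final
    by (simp only: walk_diff walk_cmult) (simp add: field_simps)
qed

text \<open>Parity excludes 0 after an odd number of steps. Positive even sample sizes thus repeat
  the previous odd value, and interpolating at odd nodes stays below them.\<close>

lemma bayes_Suc_odd:
  assumes "0 < b" "b < 1" "odd k"
  shows "bayes (Suc k) b = bayes k b"
  using bayes_Suc[OF assms(1,2), of k] walk_return_parity[of 0 k b] assms by simp

lemma bayes_odd:
  assumes b: "0 < b" "b < 1"
  shows "bayes (2 * i + 1) b = (1 - bias_sum i b) / 2"
proof (induction i)
  case 0
  then show ?case using b by (simp add: bayes_Suc bayes_0 bias_sum_def)
next
  case (Suc i)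
  have "bayes (2 * Suc i + 1) b = bayes (2 * Suc i) b - b / 2 * (cbin (Suc i) * (1 - b\<^sup>2) ^ Suc i)"
    using bayes_Suc[OF b, of "2 * Suc i"] walk_return_even[of b "Suc i"] by simp
  also have "bayes (2 * Suc i) b = bayes (2 * i + 1) b"
    using bayes_Suc_odd[OF b, of "2 * i + 1"] by simp
  also note Suc
  also have "(1 - bias_sum i b) / 2 - b / 2 * (cbin (Suc i) * (1 - b\<^sup>2) ^ Suc i) =
      (1 - bias_sum (Suc i) b) / 2"
    by (simp add: bias_sum_def algebra_simps) (simp add: field_simps)
  finally show ?case .
qed

section \<open>Convexity of the interpolated Bayes error\<close>

definition bias_term :: "nat \<Rightarrow> real \<Rightarrow> real" where
  "bias_term j b = b * (cbin j * (1 - b\<^sup>2) ^ j)"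

lemma bias_sum_eq: "bias_sum i b = (\<Sum>j\<le>i. bias_term j b)"
  by (simp add: bias_sum_def bias_term_def sum_distrib_left)

lemma bias_term_antimono:
  assumes "0 < b" "b < 1" "i \<le> j"
  shows "bias_term j b \<le> bias_term i b"
proof -
  have "b\<^sup>2 \<le> 1" using assms by (simp add: power_le_one)
  moreover have "cbin j \<le> cbin i"
    using assms(3) by (rule lift_Suc_antimono_le[of cbin, OF cbin_antimono])
  ultimately show ?thesis
    unfolding bias_term_def using assms cbin_pos
    by (intro mult_left_mono mult_mono power_decreasing) (auto intro: less_imp_le)
qed

lemma bias_term_nonneg:
  assumes "0 < b" "b < 1"
  shows "0 \<le> bias_term i b"
  using assms cbin_pos[of i] by (simp add: bias_term_def power_le_one)

text \<open>The increments \<open>bias_term\<close> decrease, so \<open>bias_sum\<close> is concave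
  in its index; the line through its values at \<open>i\<close> and \<open>Suc i\<close> lies above
  the others.\<close>

lemma bias_sum_le_line:
  assumes b: "0 < b" "b < 1"
  shows "bias_sum j b \<le> bias_sum i b + (real j - real i) * bias_term (Suc i) b"
proof (cases "i \<le> j")
  case True
  then show ?thesis
  proof (induction j rule: dec_induct)
    case (step n)
    then show ?case using bias_term_antimono[OF b, of "Suc i" "Suc n"]
      by (simp add: bias_sum_eq algebra_simps)
  qed simp
next
  case False
  then have "j \<le> i" by simp
  then show ?thesis
  proof (induction j rule: inc_induct)
    case (step n)
    then show ?case using bias_term_antimono[OF b, of "Suc n" "Suc i"]
      by (simp add: bias_sum_eq algebra_simps)
  qed simp
qed

text \<open>At \<open>\<nu> = 1\<close> the definition takes its first branch, but the formula
  agrees, since the node 3 gets weight 0.\<close>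

lemma bayes_interp_eq:
  assumes "\<nu> \<ge> 1"
  shows "bayes_interp \<nu> b =
    (2 * real (idx \<nu>) + 3 - \<nu>) / 2 * bayes (2 * idx \<nu> + 1) b +
    (\<nu> - 2 * real (idx \<nu>) - 1) / 2 * bayes (2 * idx \<nu> + 3) b"
  using assms by (cases "\<nu> = 1") (simp_all add: bayes_interp_def idx_def Let_def)

lemma idx_bounds:
  assumes "\<nu> \<ge> 1"
  shows "2 * real (idx \<nu>) + 1 \<le> \<nu>" "\<nu> \<le> 2 * real (idx \<nu>) + 3"
proof -
  have "real (idx \<nu>) = of_int \<lfloor>(\<nu> - 1) / 2\<rfloor>"
    using assms by (simp add: idx_def)
  then have "real (idx \<nu>) \<le> (\<nu> - 1) / 2 \<and> (\<nu> - 1) / 2 < real (idx \<nu>) + 1"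
    using floor_correct[of "(\<nu> - 1) / 2"] by simp
  then show "2 * real (idx \<nu>) + 1 \<le> \<nu>" "\<nu> \<le> 2 * real (idx \<nu>) + 3"
    by simp_all
qed

lemma bayes_interp_bias_sum:
  assumes b: "0 < b" "b < 1" and "\<nu> \<ge> 1"
  defines "i \<equiv> idx \<nu>"
  shows "bayes_interp \<nu> b = (1 - ((2 * real i + 3 - \<nu>) / 2 * bias_sum i b +
    (\<nu> - 2 * real i - 1) / 2 * bias_sum (Suc i) b)) / 2"
proof -
  have "bayes (2 * i + 3) b = (1 - bias_sum (Suc i) b) / 2"
    using bayes_odd[OF b, of "Suc i"] by (simp add: numeral_3_eq_3)
  moreover have "bayes (2 * i + 1) b = (1 - bias_sum i b) / 2"
    by (rule bayes_odd[OF b])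
  ultimately show ?thesis
    unfolding bayes_interp_eq[OF assms(3)] i_def[symmetric] by (simp only:) (simp add: field_simps)
qed

text \<open>Convexity in the form that Jensen's inequality needs.\<close>

lemma bayes_interp_supporting_line:
  assumes b: "0 < b" "b < 1" and \<nu>: "\<nu> \<ge> 1"
  obtains \<alpha> \<beta> where "\<And>k. \<alpha> + \<beta> * real k \<le> bayes k b" "\<alpha> + \<beta> * \<nu> = bayes_interp \<nu> b"
proof
  define i where "i = idx \<nu>"
  define a where "a = bias_term (Suc i) b"
  \<comment> \<open>The line through the nodes \<open>2 * i + 1\<close> and
    \<open>2 * i + 3\<close>: between them \<open>bayes\<close> falls by \<open>a / 2\<close>, hence
    the slope \<open>- a / 4\<close>.\<close>
  define \<alpha> where "\<alpha> = (1 - bias_sum i b + (2 * real i + 1) / 2 * a) / 2"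
  define \<beta> where "\<beta> = - a / 4"
  have a: "a \<ge> 0" unfolding a_def by (rule bias_term_nonneg[OF b])
  have line: "bias_sum j b \<le> bias_sum i b + (real j - real i) * a" for j
    unfolding a_def by (rule bias_sum_le_line[OF b])
  show "\<alpha> + \<beta> * real k \<le> bayes k b" for k
  proof -
    consider "k = 0" | j where "k = 2 * j + 1" | j where "k = Suc (2 * j + 1)"
      by (metis add_Suc_right oddE evenE Suc_eq_plus1 not0_implies_Suc even_Suc)
    then show ?thesis
    proof cases
      case 1
      \<comment> \<open>The node 0 is not of the form \<open>2 * j + 1\<close>. Here the claim
        amounts to \<open>(real i + 1 / 2) * a \<le> bias_sum i b\<close>.\<close>
      have "bias_term 0 b \<ge> a" unfolding a_def by (rule bias_term_antimono[OF b]) simp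
      then have "(real i + 1) * a \<le> bias_sum i b"
        using line[of 0] by (simp add: bias_sum_eq algebra_simps)
      then show ?thesis using 1 a by (simp add: bayes_0[OF b] \<alpha>_def \<beta>_def field_simps)
    next
      case (2 j)
      then show ?thesis using line[of j] unfolding 2 bayes_odd[OF b]
        by (simp add: \<alpha>_def \<beta>_def field_simps)
    next
      case (3 j)
      \<comment> \<open>The value is that at \<open>k - 1\<close>, and the line does not increase,
        since \<open>a \<ge> 0\<close>.\<close>
      have "bayes k b = (1 - bias_sum j b) / 2"
        using bayes_Suc_odd[OF b, of "2 * j + 1"] bayes_odd[OF b, of j] 3 by simp
      then show ?thesis using line[of j] a 3
        by (simp add: \<alpha>_def \<beta>_def field_simps)
    qed
  qed
  have "bias_sum (Suc i) b = bias_sum i b + a" by (simp add: bias_sum_eq a_def)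
  then show "\<alpha> + \<beta> * \<nu> = bayes_interp \<nu> b"
    unfolding bayes_interp_bias_sum[OF b \<nu>] i_def[symmetric] by (simp add: \<alpha>_def \<beta>_def field_simps)
qed

section \<open>Minimax lower bound\<close>

definition label_dist :: "nat \<Rightarrow> real \<Rightarrow> (nat \<Rightarrow> int) \<Rightarrow> (nat \<times> int) pmf" where
  "label_dist d b \<theta> = pmf_of_set {1..d} \<bind> (\<lambda>x. map_pmf (\<lambda>y. (x, \<theta> x * y)) (Y_pmf b))"

lemma expectation_label_dist:
  fixes f :: "nat \<times> int \<Rightarrow> real"
  assumes "d \<ge> 1" "\<bar>b\<bar> \<le> 1"
  shows "measure_pmf.expectation (label_dist d b \<theta>) f =
    (\<Sum>x=1..d. (1 + b) / 2 * f (x, \<theta> x) + (1 - b) / 2 * f (x, - \<theta> x)) / real d"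
proof -
  define E where "E x = (1 + b) / 2 * f (x, \<theta> x) + (1 - b) / 2 * f (x, - \<theta> x)" for x
  have E: "measure_pmf.expectation (map_pmf (\<lambda>y. (x, \<theta> x * y)) (Y_pmf b)) f = E x" for x
    using expectation_Y_pmf[OF assms(2), of "\<lambda>y. f (x, \<theta> x * y)"] by (simp add: E_def)
  have "measure_pmf.expectation (label_dist d b \<theta>) f =
      (\<Sum>x=1..d. measure_pmf.expectation (map_pmf (\<lambda>y. (x, \<theta> x * y)) (Y_pmf b)) f /\<^sub>R real (card {1..d}))"
    unfolding label_dist_def using assms finite_set_Y_pmf
    by (intro pmf_expectation_bind_pmf_of_set) auto
  also have "\<dots> = (\<Sum>x=1..d. E x) / real d"
    unfolding E by (simp add: sum_distrib_left divide_inverse mult.commute)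
  finally show ?thesis unfolding E_def .
qed

lemma set_Y_pmf: "set_pmf (Y_pmf b) \<subseteq> {1, - 1}"
  by (auto simp: Y_pmf_def)

lemma label_dist_in_distributions:
  assumes "d \<ge> 1" "\<theta> \<in> hypotheses d"
  shows "label_dist d b \<theta> \<in> distributions d"
proof -
  have "\<theta> x = - 1 \<or> \<theta> x = 1" if "x \<in> {1..d}" for x
    using PiE_mem[OF assms(2)[unfolded hypotheses_def] that] by (auto simp: labels_def)
  then show ?thesis
    using assms(1) set_Y_pmf[of b]
    by (fastforce simp: distributions_def label_dist_def labels_def set_pmf_of_set)
qed

lemma finite_set_pmf_distributions:
  assumes "D \<in> distributions d"
  shows "finite (set_pmf D)"
  using assms by (auto simp: distributions_def labels_def intro: finite_subset)

lemma set_replicate_pmf_samples: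
  assumes "D \<in> distributions d"
  shows "set_pmf (replicate_pmf m D) \<subseteq> samples m d"
  using assms by (auto simp: set_replicate_pmf samples_def distributions_def)

lemma finite_samples: "finite (samples m d)"
proof -
  have "finite ({1..d} \<times> labels)" by (simp add: labels_def)
  from finite_lists_length_eq[OF this, of m] show ?thesis
    by (simp add: samples_def conj_commute)
qed

lemma integrable_replicate_pmf:
  fixes f :: "(nat \<times> int) list \<Rightarrow> real"
  assumes "D \<in> distributions d"
  shows "integrable (measure_pmf (replicate_pmf m D)) f"
  by (rule integrable_measure_pmf_finite)
    (rule finite_subset[OF set_replicate_pmf_samples[OF assms] finite_samples])

lemma finite_hypotheses: "finite (hypotheses d)"
  by (simp add: hypotheses_def labels_def finite_PiE)

lemma hypotheses_nonempty: "hypotheses d \<noteq> {}"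
  by (simp add: hypotheses_def labels_def PiE_eq_empty_iff)

lemma err_label_dist:
  assumes d: "d \<ge> 1" and b: "\<bar>b\<bar> \<le> 1" and h: "h \<in> hypotheses d" "\<theta> \<in> hypotheses d"
  shows "err h (label_dist d b \<theta>) =
    (1 - b) / 2 + b / real d * (\<Sum>x=1..d. if h x \<noteq> \<theta> x then 1 else 0)"
proof -
  let ?E = "{(x, y). h x \<noteq> y}"
  have "(1 + b) / 2 * indicat_real ?E (x, \<theta> x) + (1 - b) / 2 * indicat_real ?E (x, - \<theta> x) =
      (1 - b) / 2 + b * (if h x \<noteq> \<theta> x then 1 else 0)" if "x \<in> {1..d}" for x
    using PiE_mem[OF h(1)[unfolded hypotheses_def] that] PiE_mem[OF h(2)[unfolded hypotheses_def] that]
    by (auto simp: labels_def indicator_def field_simps)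
  then have "(\<Sum>x=1..d. (1 + b) / 2 * indicat_real ?E (x, \<theta> x) + (1 - b) / 2 * indicat_real ?E (x, - \<theta> x)) =
      (\<Sum>x=1..d. (1 - b) / 2 + b * (if h x \<noteq> \<theta> x then 1 else 0))"
    by (rule sum.cong[OF refl])
  also have "\<dots> = real d * ((1 - b) / 2) + b * (\<Sum>x=1..d. if h x \<noteq> \<theta> x then 1 else 0)"
    by (simp only: sum.distrib sum_distrib_left[symmetric]) simp
  finally show ?thesis
    using expectation_label_dist[OF d b, of \<theta> "indicat_real ?E"] d
    by (simp add: err_def add_divide_distrib)
qed

text \<open>As \<open>b \<ge> 0\<close>, no disagreement with \<open>\<theta>\<close> lowers the
  error, so \<open>\<theta>\<close> itself attains the minimum \<open>(1 - b) / 2\<close>.\<close>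

lemma excess_label_dist:
  assumes d: "d \<ge> 1" and b: "0 \<le> b" "b \<le> 1" and h: "h \<in> hypotheses d" "\<theta> \<in> hypotheses d"
  shows "excess d h (label_dist d b \<theta>) = b / real d * (\<Sum>x=1..d. if h x \<noteq> \<theta> x then 1 else 0)"
proof -
  have err: "err g (label_dist d b \<theta>) =
      (1 - b) / 2 + b / real d * (\<Sum>x=1..d. if g x \<noteq> \<theta> x then 1 else 0)" if "g \<in> hypotheses d" for g
    using err_label_dist[OF d _ that h(2), of b] b by simp
  have "(MIN g\<in>hypotheses d. err g (label_dist d b \<theta>)) = (1 - b) / 2"
  proof (rule Min_eqI)
    show "(1 - b) / 2 \<le> y" if mem: "y \<in> (\<lambda>g. err g (label_dist d b \<theta>)) ` hypotheses d" for y
    proof -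
      obtain g where "g \<in> hypotheses d" and y: "y = err g (label_dist d b \<theta>)" using mem by auto
      moreover have "0 \<le> b / real d * (\<Sum>x=1..d. if g x \<noteq> \<theta> x then 1 else 0)"
        using b by (intro mult_nonneg_nonneg sum_nonneg) auto
      ultimately show ?thesis unfolding y by (simp add: err)
    qed
    show "(1 - b) / 2 \<in> (\<lambda>g. err g (label_dist d b \<theta>)) ` hypotheses d"
      using err[OF h(2)] h(2) by (auto simp: image_iff intro!: bexI[of _ \<theta>])
  qed (simp add: finite_hypotheses)
  then show ?thesis by (simp add: excess_def err[OF h(1)])
qed

text \<open>For \<open>s = \<theta> x\<close>, the step of the walk at \<open>x\<close> caused by
  one observation: up if its label agrees with \<open>\<theta>\<close>, down if not, none at other
  points.\<close>

definition score :: "nat \<Rightarrow> int \<Rightarrow> nat \<times> int \<Rightarrow> int" where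
  "score x s a = (if fst a = x then s * snd a else 0)"

definition total_score :: "nat \<Rightarrow> int \<Rightarrow> (nat \<times> int) list \<Rightarrow> int" where
  "total_score x s z = sum_list (map (score x s) z)"

lemma hypotheses_sq:
  assumes "\<theta> \<in> hypotheses d" "x \<in> {1..d}"
  shows "\<theta> x * \<theta> x = 1"
  using PiE_mem[OF assms(1)[unfolded hypotheses_def] assms(2)] by (auto simp: labels_def)

lemma flip_in_hypotheses:
  assumes "\<theta> \<in> hypotheses d" "x \<in> {1..d}"
  shows "\<theta>(x := - \<theta> x) \<in> hypotheses d"
  using assms by (fastforce simp: hypotheses_def labels_def PiE_iff extensional_def)

section \<open>Flipping the labelling at one point\<close>

context
  fixes d :: nat and b r :: real and \<theta> :: "nat \<Rightarrow> int" and x :: nat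
  assumes d: "d \<ge> 1" and b: "0 < b" "b < 1" and \<theta>: "\<theta> \<in> hypotheses d" and x: "x \<in> {1..d}"
  defines "r \<equiv> (1 - b) / (1 + b)"
begin

text \<open>The flip exchanges the two label probabilities at \<open>x\<close> only, so the
  likelihood ratio of one observation is \<open>r\<close> or \<open>1 / r\<close> there and 1
  elsewhere.\<close>

lemma label_dist_flip:
  "measure_pmf.expectation (label_dist d b (\<theta>(x := - \<theta> x))) f =
    measure_pmf.expectation (label_dist d b \<theta>) (\<lambda>a. r powi score x (\<theta> x) a * f a)"
proof -
  have b1: "\<bar>b\<bar> \<le> 1" using b by simp
  have r1: "(1 + b) / 2 * r = (1 - b) / 2"
    unfolding r_def by (rule ratio_simps(1)[OF b])
  have r2: "(1 - b) / 2 * inverse r = (1 + b) / 2"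
    unfolding r_def divide_inverse[symmetric] by (rule ratio_simps(2)[OF b])
  have "(1 + b) / 2 * f (x', (\<theta>(x := - \<theta> x)) x') + (1 - b) / 2 * f (x', - (\<theta>(x := - \<theta> x)) x') =
      (1 + b) / 2 * (r powi score x (\<theta> x) (x', \<theta> x') * f (x', \<theta> x')) +
      (1 - b) / 2 * (r powi score x (\<theta> x) (x', - \<theta> x') * f (x', - \<theta> x'))" for x'
  proof (cases "x' = x")
    case True
    have "score x (\<theta> x) (x, \<theta> x) = 1" "score x (\<theta> x) (x, - \<theta> x) = - 1"
      using hypotheses_sq[OF \<theta> x] by (simp_all add: score_def)
    then have "(1 + b) / 2 * (r powi score x (\<theta> x) (x, \<theta> x) * f (x, \<theta> x)) +
      (1 - b) / 2 * (r powi score x (\<theta> x) (x, - \<theta> x) * f (x, - \<theta> x)) =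
      ((1 + b) / 2 * r) * f (x, \<theta> x) + ((1 - b) / 2 * inverse r) * f (x, - \<theta> x)"
      by (simp only: power_int_minus power_int_1_right mult.assoc)
    then show ?thesis unfolding r1 r2 using True by simp
  qed (simp add: score_def)
  then show ?thesis by (simp only: expectation_label_dist[OF d b1])
qed

lemma replicate_label_dist_flip:
  "measure_pmf.expectation (replicate_pmf m (label_dist d b (\<theta>(x := - \<theta> x)))) g =
    measure_pmf.expectation (replicate_pmf m (label_dist d b \<theta>))
      (\<lambda>z. r powi total_score x (\<theta> x) z * g z)"
proof (induction m arbitrary: g)
  case 0
  then show ?case by (simp add: total_score_def)
next
  case (Suc m)
  have r: "r \<noteq> 0" using b by (simp add: r_def)
  have fin: "finite (set_pmf (label_dist d b \<theta>))" "finite (set_pmf (label_dist d b (\<theta>(x := - \<theta> x))))"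
    using finite_set_pmf_distributions label_dist_in_distributions d \<theta> flip_in_hypotheses[OF \<theta> x]
    by blast+
  have "r powi total_score x (\<theta> x) (a # z) = r powi score x (\<theta> x) a * r powi total_score x (\<theta> x) z" for a z
    using r by (simp add: total_score_def power_int_add)
  then show ?case
    unfolding expectation_replicate_pmf_Suc[OF fin(1)] expectation_replicate_pmf_Suc[OF fin(2)]
      Suc label_dist_flip
    by (simp add: mult.assoc)
qed

text \<open>Jensen's inequality by induction on the number \<open>m\<close> of draws, where
  \<open>k\<close> counts the draws at \<open>x\<close> already turned into steps of the walk. A
  draw falls on \<open>x\<close> with probability \<open>1 / d\<close> and then raises
  \<open>k\<close> by one; the affine bound averages exactly, and the binomial law need not be
  written out.\<close>

lemma expectation_walk_total_score_ge:
  assumes line: "\<And>k. \<alpha> + \<beta> * real k \<le> bayes k b"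
  shows "2 * (\<alpha> + \<beta> * (real k + real m / real d)) \<le>
    measure_pmf.expectation (replicate_pmf m (label_dist d b \<theta>))
      (\<lambda>z. walk b k (min_ratio b) (total_score x (\<theta> x) z))"
proof (induction m arbitrary: k)
  case 0
  then show ?case using line[of k] by (simp add: total_score_def bayes_eq_walk[OF b])
next
  case (Suc m)
  let ?D = "label_dist d b \<theta>"
  let ?w = "walk b k (min_ratio b)"
  have D: "?D \<in> distributions d" by (rule label_dist_in_distributions[OF d \<theta>])
  have b1: "\<bar>b\<bar> \<le> 1" using b by simp
  have int: "integrable (measure_pmf (replicate_pmf m ?D)) f" for f :: "(nat \<times> int) list \<Rightarrow> real"
    by (rule integrable_replicate_pmf[OF D])
  define A where "A s = measure_pmf.expectation (replicate_pmf m ?D)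
      (\<lambda>z. ?w (s + total_score x (\<theta> x) z))" for s
  have A0: "2 * (\<alpha> + \<beta> * (real k + real m / real d)) \<le> A 0"
    using Suc[of k] by (simp add: A_def)
  \<comment> \<open>A draw at \<open>x\<close>, averaged over its label, has the law of one step and
    is absorbed into the walk.\<close>
  have "(1 + b) / 2 * A 1 + (1 - b) / 2 * A (- 1) =
      measure_pmf.expectation (replicate_pmf m ?D)
        (\<lambda>z. walk b (Suc k) (min_ratio b) (total_score x (\<theta> x) z))"
    unfolding A_def by (simp add: int add.commute)
  then have A1: "2 * (\<alpha> + \<beta> * (real (Suc k) + real m / real d)) \<le> (1 + b) / 2 * A 1 + (1 - b) / 2 * A (- 1)"
    using Suc[of "Suc k"] by simp
  have "measure_pmf.expectation (replicate_pmf (Suc m) ?D) (\<lambda>z. ?w (total_score x (\<theta> x) z)) =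
      measure_pmf.expectation ?D (\<lambda>a. A (score x (\<theta> x) a))"
    unfolding expectation_replicate_pmf_Suc[OF finite_set_pmf_distributions[OF D]]
    by (simp add: A_def total_score_def)
  also have "\<dots> = (\<Sum>x'=1..d. (1 + b) / 2 * A (score x (\<theta> x) (x', \<theta> x')) +
      (1 - b) / 2 * A (score x (\<theta> x) (x', - \<theta> x'))) / real d"
    by (rule expectation_label_dist[OF d b1])
  also have "(\<Sum>x'=1..d. (1 + b) / 2 * A (score x (\<theta> x) (x', \<theta> x')) +
      (1 - b) / 2 * A (score x (\<theta> x) (x', - \<theta> x'))) =
      (\<Sum>x'=1..d. A 0 + (if x' = x then (1 + b) / 2 * A 1 + (1 - b) / 2 * A (- 1) - A 0 else 0))"
  proof (rule sum.cong[OF refl])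
    fix x' assume "x' \<in> {1..d}"
    show "(1 + b) / 2 * A (score x (\<theta> x) (x', \<theta> x')) + (1 - b) / 2 * A (score x (\<theta> x) (x', - \<theta> x')) =
        A 0 + (if x' = x then (1 + b) / 2 * A 1 + (1 - b) / 2 * A (- 1) - A 0 else 0)"
      using hypotheses_sq[OF \<theta> x] by (simp add: score_def) (simp add: field_simps)
  qed
  also have "\<dots> = (real d - 1) * A 0 + ((1 + b) / 2 * A 1 + (1 - b) / 2 * A (- 1))"
    using x by (simp only: sum.distrib sum.delta[OF finite_atLeastAtMost]) (simp add: algebra_simps)
  finally have eq: "measure_pmf.expectation (replicate_pmf (Suc m) ?D) (\<lambda>z. ?w (total_score x (\<theta> x) z)) =
      ((real d - 1) * A 0 + ((1 + b) / 2 * A 1 + (1 - b) / 2 * A (- 1))) / real d" .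
  have "(real d - 1) * (2 * (\<alpha> + \<beta> * (real k + real m / real d))) +
      2 * (\<alpha> + \<beta> * (real (Suc k) + real m / real d)) \<le>
      (real d - 1) * A 0 + ((1 + b) / 2 * A 1 + (1 - b) / 2 * A (- 1))"
    using d A0 A1 by (intro add_mono mult_left_mono) auto
  also have "(real d - 1) * (2 * (\<alpha> + \<beta> * (real k + real m / real d))) +
      2 * (\<alpha> + \<beta> * (real (Suc k) + real m / real d)) =
      2 * (\<alpha> + \<beta> * (real k + real (Suc m) / real d)) * real d"
    using d by (simp add: field_simps)
  finally show ?case unfolding eq using d by (simp add: le_divide_eq)
qed

lemma flip_error_sum_ge:
  assumes \<nu>: "\<nu> = real m / real d" "\<nu> \<ge> 1"
  shows "2 * bayes_interp \<nu> b \<le>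
    measure_pmf.expectation (replicate_pmf m (label_dist d b \<theta>))
      (\<lambda>z. if L z x \<noteq> \<theta> x then 1 else 0) +
    measure_pmf.expectation (replicate_pmf m (label_dist d b (\<theta>(x := - \<theta> x))))
      (\<lambda>z. if L z x \<noteq> - \<theta> x then 1 else 0)"
proof -
  let ?P = "measure_pmf (replicate_pmf m (label_dist d b \<theta>))"
  obtain \<alpha> \<beta> where line: "\<And>k. \<alpha> + \<beta> * real k \<le> bayes k b" "\<alpha> + \<beta> * \<nu> = bayes_interp \<nu> b"
    using bayes_interp_supporting_line[OF b \<nu>(2)] by blast
  have int: "integrable ?P f" for f :: "(nat \<times> int) list \<Rightarrow> real"
    by (rule integrable_replicate_pmf[OF label_dist_in_distributions[OF d \<theta>]])
  have r: "r > 0" using b by (simp add: r_def)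
  have "\<theta> x \<noteq> 0" using hypotheses_sq[OF \<theta> x] by auto
  have "2 * bayes_interp \<nu> b \<le> (\<integral>z. min_ratio b (total_score x (\<theta> x) z) \<partial>?P)"
    using expectation_walk_total_score_ge[of \<alpha> \<beta> 0 m, OF line(1)] line(2) \<nu>(1) by simp
  \<comment> \<open>Any prediction misses at least one of the distinct values
    \<open>\<theta> x\<close> and \<open>- \<theta> x\<close>, so the integrand is at least the
    smaller of the two weights.\<close>
  also have "\<dots> \<le> (\<integral>z. (if L z x \<noteq> \<theta> x then 1 else 0) +
      r powi total_score x (\<theta> x) z * (if L z x \<noteq> - \<theta> x then 1 else 0) \<partial>?P)"
    using r \<open>\<theta> x \<noteq> 0\<close> by (intro integral_mono int) (auto simp: min_ratio_def r_def min_def)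
  also have "\<dots> = (\<integral>z. (if L z x \<noteq> \<theta> x then 1 else 0) \<partial>?P) +
      (\<integral>z. r powi total_score x (\<theta> x) z * (if L z x \<noteq> - \<theta> x then 1 else 0) \<partial>?P)"
    by (rule Bochner_Integration.integral_add[OF int int])
  finally show ?thesis unfolding replicate_label_dist_flip .
qed

end

text \<open>Flipping at \<open>x\<close> permutes the labellings, so summing
  \<open>flip_error_sum_ge\<close> over all of them counts each error probability twice. In effect
  this bounds the risk averaged over \<open>\<theta>\<close>.\<close>

lemma sum_risk_ge:
  assumes d: "d \<ge> 1" and b: "0 < b" "b < 1" and L: "L \<in> learners m d"
    and \<nu>: "\<nu> = real m / real d" "\<nu> \<ge> 1"
  shows "real (card (hypotheses d)) * (b * bayes_interp \<nu> b) \<le>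
    (\<Sum>\<theta>\<in>hypotheses d. risk m d L (label_dist d b \<theta>))"
proof -
  define e where "e \<theta> x = measure_pmf.expectation (replicate_pmf m (label_dist d b \<theta>))
      (\<lambda>z. if L z x \<noteq> \<theta> x then 1 else 0 :: real)" for \<theta> x
  have risk: "risk m d L (label_dist d b \<theta>) = b / real d * (\<Sum>x=1..d. e \<theta> x)"
    if "\<theta> \<in> hypotheses d" for \<theta>
  proof -
    have D: "label_dist d b \<theta> \<in> distributions d" by (rule label_dist_in_distributions[OF d that])
    have "risk m d L (label_dist d b \<theta>) = measure_pmf.expectation (replicate_pmf m (label_dist d b \<theta>))
        (\<lambda>z. b / real d * (\<Sum>x=1..d. if L z x \<noteq> \<theta> x then 1 else 0))"
      unfolding risk_def
    proof (rule integral_cong_AE)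
      \<comment> \<open>\<open>L z\<close> is known to be a hypothesis only for \<open>z\<close> in
        \<open>samples m d\<close>, hence the argument almost everywhere.\<close>
      have "excess d (L z) (label_dist d b \<theta>) = b / real d * (\<Sum>x=1..d. if L z x \<noteq> \<theta> x then 1 else 0)"
        if "z \<in> set_pmf (replicate_pmf m (label_dist d b \<theta>))" for z
        using set_replicate_pmf_samples[OF D] that L b \<open>\<theta> \<in> hypotheses d\<close> d
        by (intro excess_label_dist) (auto simp: learners_def)
      then show "AE z in replicate_pmf m (label_dist d b \<theta>).
          excess d (L z) (label_dist d b \<theta>) = b / real d * (\<Sum>x=1..d. if L z x \<noteq> \<theta> x then 1 else 0)"
        by (simp add: AE_measure_pmf_iff)
    qed auto
    also have "\<dots> = b / real d * (\<Sum>x=1..d. e \<theta> x)"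
      unfolding e_def by (simp add: Bochner_Integration.integral_sum integrable_replicate_pmf[OF D])
    finally show ?thesis .
  qed
  have e: "real (card (hypotheses d)) * bayes_interp \<nu> b \<le> (\<Sum>\<theta>\<in>hypotheses d. e \<theta> x)"
    if x: "x \<in> {1..d}" for x
  proof -
    have "(\<Sum>\<theta>\<in>hypotheses d. 2 * bayes_interp \<nu> b) \<le>
        (\<Sum>\<theta>\<in>hypotheses d. e \<theta> x + e (\<theta>(x := - \<theta> x)) x)"
      using flip_error_sum_ge[OF d b _ x \<nu>] by (intro sum_mono) (simp add: e_def)
    also have "\<dots> = (\<Sum>\<theta>\<in>hypotheses d. e \<theta> x) + (\<Sum>\<theta>\<in>hypotheses d. e (\<theta>(x := - \<theta> x)) x)"
      by (rule sum.distrib)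
    also have "(\<Sum>\<theta>\<in>hypotheses d. e (\<theta>(x := - \<theta> x)) x) = (\<Sum>\<theta>\<in>hypotheses d. e \<theta> x)"
      using flip_in_hypotheses[OF _ x]
      by (intro sum.reindex_bij_witness[of _ "\<lambda>\<theta>. \<theta>(x := - \<theta> x)" "\<lambda>\<theta>. \<theta>(x := - \<theta> x)"]) simp_all
    finally show ?thesis by simp
  qed
  have "real (card (hypotheses d)) * (b * bayes_interp \<nu> b) =
      b / real d * (\<Sum>x=1..d. real (card (hypotheses d)) * bayes_interp \<nu> b)"
    using d by simp
  also have "\<dots> \<le> b / real d * (\<Sum>x=1..d. \<Sum>\<theta>\<in>hypotheses d. e \<theta> x)"
    using e b by (intro mult_left_mono sum_mono) auto
  also have "\<dots> = (\<Sum>\<theta>\<in>hypotheses d. risk m d L (label_dist d b \<theta>))"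
    by (subst sum.swap) (simp add: risk sum_distrib_left)
  finally show ?thesis .
qed

text \<open>\<open>h\<close> need not be a hypothesis here, so the lower bound is -1 rather than 0.
  The bounds serve for integrability and for bounded suprema.\<close>

lemma excess_bounds:
  shows "excess d h D \<le> 1" and "- 1 \<le> excess d h D"
proof -
  have "0 \<le> (MIN g\<in>hypotheses d. err g D)" "(MIN g\<in>hypotheses d. err g D) \<le> 1"
    using finite_hypotheses[of d] hypotheses_nonempty[of d]
    by (auto simp: err_def Min_le_iff ex_in_conv)
  moreover have "0 \<le> err h D" "err h D \<le> 1" by (simp_all add: err_def)
  ultimately show "excess d h D \<le> 1" "- 1 \<le> excess d h D" by (simp_all add: excess_def)
qed

lemma risk_le_1:
  assumes "D \<in> distributions d"
  shows "risk m d L D \<le> 1"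
  unfolding risk_def
  by (intro measure_pmf.integral_le_const integrable_replicate_pmf[OF assms])
    (simp add: excess_bounds)

section \<open>Randomized algorithms\<close>

lemma prob_space_unif: "prob_space unif"
  unfolding unif_def
  by (rule prob_space_uniform_measure) (simp_all add: emeasure_restrict_space)

lemma rand_learners_fix:
  assumes "L \<in> rand_learners m d" "u \<in> space unif"
  shows "(\<lambda>z. L z u) \<in> learners m d"
  using assms by (auto simp: rand_learners_def learners_def dest!: PiE_mem Pi_mem measurable_space)

text \<open>Fubini's theorem: for fixed \<open>u\<close> the algorithm is deterministic, and the
  randomized risk is the average of the deterministic ones.\<close>

lemma rand_risk_eq:
  assumes L: "L \<in> rand_learners m d" and D: "D \<in> distributions d"
  shows "integrable unif (\<lambda>u. risk m d (\<lambda>z. L z u) D)"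
    and "rand_risk m d L D = (\<integral>u. risk m d (\<lambda>z. L z u) D \<partial>unif)"
proof -
  let ?P = "measure_pmf (replicate_pmf m D)"
  let ?R = "restrict_space ?P (samples m d)"
  have P1: "emeasure ?P (samples m d) = 1"
    using set_replicate_pmf_samples[OF D]
    by (intro measure_pmf.emeasure_eq_1_AE) (auto simp: AE_measure_pmf_iff)
  interpret R: prob_space ?R
    by (rule prob_space_restrict_space) (simp_all add: P1)
  interpret U: prob_space unif by (rule prob_space_unif)
  interpret RU: pair_prob_space ?R unif ..
  have sets: "sets ?R = sets (count_space (samples m d))"
    by (auto simp: sets_restrict_space)
  \<comment> \<open>Measurability in \<open>u\<close> alone suffices, because there are only
    finitely many samples.\<close>
  have "(\<lambda>(z, u). excess d (L z u) D) \<in> borel_measurable (count_space (samples m d) \<Otimes>\<^sub>M unif)"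
  proof (rule measurable_pair_measure_countable1)
    fix z assume "z \<in> samples m d"
    then have "L z \<in> unif \<rightarrow>\<^sub>M count_space (hypotheses d)"
      using L by (auto simp: rand_learners_def)
    then show "(\<lambda>u. case (z, u) of (z, u) \<Rightarrow> excess d (L z u) D) \<in> borel_measurable unif"
      by (simp add: measurable_compose[where g = "\<lambda>h. excess d h D"])
  qed (simp add: countable_finite finite_samples)
  then have "(\<lambda>(z, u). excess d (L z u) D) \<in> borel_measurable (?R \<Otimes>\<^sub>M unif)"
    by (subst measurable_cong_sets[OF sets_pair_measure_cong[OF sets refl] refl])
  then have int: "integrable (?R \<Otimes>\<^sub>M unif) (\<lambda>(z, u). excess d (L z u) D)"
    using excess_bounds by (intro RU.integrable_const_bound[where B = 1]) (auto simp: abs_le_iff minus_le_iff)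
  have risk: "(\<integral>z. excess d (L z u) D \<partial>?R) = risk m d (\<lambda>z. L z u) D" for u
    unfolding risk_def using set_replicate_pmf_samples[OF D, of m]
    by (subst integral_restrict_space)
      (auto intro!: integral_cong_AE simp: AE_measure_pmf_iff indicator_def)
  show "integrable unif (\<lambda>u. risk m d (\<lambda>z. L z u) D)"
    using RU.integrable_snd[OF int] by (simp add: risk)
  show "rand_risk m d L D = (\<integral>u. risk m d (\<lambda>z. L z u) D \<partial>unif)"
    using RU.integral_snd[OF int] by (simp add: risk rand_risk_def)
qed

lemma rand_risk_le_1:
  assumes "L \<in> rand_learners m d" "D \<in> distributions d"
  shows "rand_risk m d L D \<le> 1"
  unfolding rand_risk_eq(2)[OF assms]
  by (intro prob_space.integral_le_const[OF prob_space_unif] rand_risk_eq(1)[OF assms])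
    (simp add: risk_le_1[OF assms(2)])

lemma sum_rand_risk_ge:
  assumes d: "d \<ge> 1" and b: "0 < b" "b < 1" and L: "L \<in> rand_learners m d"
    and \<nu>: "\<nu> = real m / real d" "\<nu> \<ge> 1"
  shows "real (card (hypotheses d)) * (b * bayes_interp \<nu> b) \<le>
    (\<Sum>\<theta>\<in>hypotheses d. rand_risk m d L (label_dist d b \<theta>))"
proof -
  have int: "integrable unif (\<lambda>u. risk m d (\<lambda>z. L z u) (label_dist d b \<theta>))"
    if "\<theta> \<in> hypotheses d" for \<theta>
    by (rule rand_risk_eq(1)[OF L label_dist_in_distributions[OF d that]])
  have "real (card (hypotheses d)) * (b * bayes_interp \<nu> b) \<le>
      (\<integral>u. (\<Sum>\<theta>\<in>hypotheses d. risk m d (\<lambda>z. L z u) (label_dist d b \<theta>)) \<partial>unif)"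
    using sum_risk_ge[OF d b rand_learners_fix[OF L] \<nu>] int
    by (intro prob_space.integral_ge_const[OF prob_space_unif]) auto
  also have "\<dots> = (\<Sum>\<theta>\<in>hypotheses d. rand_risk m d L (label_dist d b \<theta>))"
    using int rand_risk_eq(2)[OF L label_dist_in_distributions[OF d]]
    by (simp add: Bochner_Integration.integral_sum)
  finally show ?thesis .
qed

text \<open>The supremum over distributions is at least the average over the labellings
  \<open>\<theta>\<close>. The class and the risk are abstract so as to cover both kinds of
  algorithms; \<open>bdd\<close> makes the real suprema meaningful.\<close>

lemma minimax_ge:
  fixes R :: "'l \<Rightarrow> (nat \<times> int) pmf \<Rightarrow> real"
  assumes d: "d \<ge> 1" and ne: "\<L> \<noteq> {}"
    and bdd: "\<And>L D. L \<in> \<L> \<Longrightarrow> D \<in> distributions d \<Longrightarrow> R L D \<le> 1"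
    and avg: "\<And>b L. 0 < b \<Longrightarrow> b < 1 \<Longrightarrow> L \<in> \<L> \<Longrightarrow>
      real (card (hypotheses d)) * (b * bayes_interp \<nu> b) \<le>
        (\<Sum>\<theta>\<in>hypotheses d. R L (label_dist d b \<theta>))"
  shows "B1 \<nu> \<le> (INF L\<in>\<L>. SUP D\<in>distributions d. R L D)"
proof (rule cINF_greatest[OF ne])
  fix L assume L: "L \<in> \<L>"
  have bdd: "bdd_above (R L ` distributions d)"
    using bdd[OF L] by (auto intro!: bdd_aboveI2[of _ _ 1])
  show "B1 \<nu> \<le> (SUP D\<in>distributions d. R L D)"
    unfolding B1_def
  proof (rule cSUP_least)
    fix b :: real assume b: "b \<in> {0<..<1}"
    have "\<exists>\<theta>\<in>hypotheses d. b * bayes_interp \<nu> b \<le> R L (label_dist d b \<theta>)"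
    proof (rule ccontr)
      assume "\<not> ?thesis"
      then have "(\<Sum>\<theta>\<in>hypotheses d. R L (label_dist d b \<theta>)) < (\<Sum>\<theta>\<in>hypotheses d. b * bayes_interp \<nu> b)"
        using finite_hypotheses hypotheses_nonempty by (intro sum_strict_mono) auto
      then show False using avg[OF _ _ L, of b] b by simp
    qed
    then show "b * bayes_interp \<nu> b \<le> (SUP D\<in>distributions d. R L D)"
      using label_dist_in_distributions[OF d] by (blast intro: cSUP_upper2[OF bdd])
  qed simp
qed

section \<open>The bounds \<open>B1\<close> and \<open>B2\<close>\<close>

lemma B2_le_B1:
  assumes \<nu>: "\<nu> \<ge> 1"
  shows "B2 \<nu> \<le> B1 \<nu>"
proof -
  define i where "i = idx \<nu>"
  \<comment> \<open>With this \<open>b\<close>, the error function is taken at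
    \<open>z_star / sqrt 2\<close> whatever \<open>\<nu>\<close> is, and the main term
    \<open>b / 2 * (1 - erf (b * sqrt (\<nu> / 2)))\<close> becomes
    \<open>c_inf / sqrt \<nu>\<close>, its largest value over positive \<open>b\<close>.\<close>
  define b where "b = z_star / sqrt \<nu>"
  have sums: "0 \<le> (2 * real i + 3 - \<nu>) / 2 * bias_sum i b + (\<nu> - 2 * real i - 1) / 2 * bias_sum (Suc i) b"
    if "0 < b" "b < 1" for b
  proof -
    have "0 \<le> bias_sum j b" for j
      unfolding bias_sum_eq by (intro sum_nonneg bias_term_nonneg[OF that])
    then show ?thesis
      using idx_bounds[OF \<nu>] by (intro add_nonneg_nonneg mult_nonneg_nonneg) (auto simp: i_def)
  qed
  \<comment> \<open>Boundedness is needed for the real supremum \<open>B1 \<nu>\<close> to dominate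
    the value at the chosen \<open>b\<close>.\<close>
  have "b * bayes_interp \<nu> b \<le> 1" if "b \<in> {0<..<1}" for b
  proof -
    have "bayes_interp \<nu> b \<le> 1"
      using sums[of b] that \<nu> by (simp add: bayes_interp_bias_sum i_def)
    then have "b * bayes_interp \<nu> b \<le> b * 1" using that by (intro mult_left_mono) auto
    also have "\<dots> \<le> 1" using that by simp
    finally show ?thesis .
  qed
  then have bdd: "bdd_above ((\<lambda>b. b * bayes_interp \<nu> b) ` {0<..<1})"
    by (auto intro!: bdd_aboveI2[of _ _ 1])
  have "1 \<le> sqrt \<nu>" using \<nu> by simp
  then have "z_star < sqrt \<nu>" using z_star_bounds(2) by linarith
  moreover have "0 < \<nu>" using \<nu> by simp
  ultimately have b: "0 < b" "b < 1" using z_star_bounds(1) by (simp_all add: b_def)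
  have "b * sqrt (\<nu> / 2) = z_star / sqrt 2" "b\<^sup>2 / 6 = z_star\<^sup>2 / (6 * \<nu>)"
    using \<nu> by (simp_all add: b_def real_sqrt_divide power_divide)
  moreover have "e * exp t = e / exp (- t)" for e t :: real
    by (simp add: exp_minus field_simps)
  ultimately have "(2 * real i + 3 - \<nu>) / 2 * bias_sum i b + (\<nu> - 2 * real i - 1) / 2 * bias_sum (Suc i) b \<le>
      C_coef i * (erf (z_star / sqrt 2) / exp (- (z_star\<^sup>2 / (6 * \<nu>))))"
    using interpolated_bias_sum_le_erf[OF less_imp_le[OF b(1)] less_imp_le[OF b(2)] idx_bounds[OF \<nu>]]
    by (simp only: i_def mult.assoc times_divide_eq_right)
  then have "b * ((1 - C_coef i * (erf (z_star / sqrt 2) / exp (- (z_star\<^sup>2 / (6 * \<nu>))))) / 2) \<le>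
      b * bayes_interp \<nu> b"
    using b \<nu> unfolding bayes_interp_bias_sum[OF b \<nu>] i_def[symmetric]
    by (intro mult_left_mono divide_right_mono diff_left_mono) auto
  also have "\<dots> \<le> B1 \<nu>"
    unfolding B1_def using b by (intro cSUP_upper bdd) auto
  finally show ?thesis
    by (simp add: B2_def c_nu_def b_def i_def mult_ac)
qed

lemma learners_nonempty: "learners m d \<noteq> {}"
proof -
  obtain h where "h \<in> hypotheses d" using hypotheses_nonempty by blast
  then have "(\<lambda>_. h) \<in> learners m d" by (simp add: learners_def)
  then show ?thesis by blast
qed

lemma rand_learners_nonempty: "rand_learners m d \<noteq> {}"
proof -
  obtain h where "h \<in> hypotheses d" using hypotheses_nonempty by blast
  then have "(\<lambda>_ _. h) \<in> rand_learners m d" by (simp add: rand_learners_def)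
  then show ?thesis by blast
qed

theorem theorem2p11:
  fixes m d :: nat and \<nu> :: real
  assumes "m \<ge> 1" and "d \<ge> 1" and "\<nu> = real m / real d" and "\<nu> \<ge> 1"
  shows "(INF L\<in>learners m d. SUP D\<in>distributions d. risk m d L D) \<ge> B1 \<nu>
    \<and> (INF L\<in>rand_learners m d. SUP D\<in>distributions d. rand_risk m d L D) \<ge> B1 \<nu>
    \<and> B1 \<nu> \<ge> B2 \<nu>
    \<and> c_nu \<nu> < c_inf
    \<and> (\<nu> \<ge> 3 \<longrightarrow> B2 \<nu> \<ge> B2_tilde \<nu> \<and> c_tilde \<nu> \<le> c_nu \<nu>)"
proof (intro conjI impI)
  show "(INF L\<in>learners m d. SUP D\<in>distributions d. risk m d L D) \<ge> B1 \<nu>"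
    using assms by (intro minimax_ge learners_nonempty risk_le_1 sum_risk_ge) auto
  show "(INF L\<in>rand_learners m d. SUP D\<in>distributions d. rand_risk m d L D) \<ge> B1 \<nu>"
    using assms by (intro minimax_ge rand_learners_nonempty rand_risk_le_1 sum_rand_risk_ge) auto
  show "B1 \<nu> \<ge> B2 \<nu>" by (rule B2_le_B1[OF assms(4)])
  show "c_nu \<nu> < c_inf" using assms(4) by (intro c_nu_less_c_inf) simp
  assume "\<nu> \<ge> 3"
  then show "c_tilde \<nu> \<le> c_nu \<nu>" by (rule c_tilde_le_c_nu)
  then show "B2 \<nu> \<ge> B2_tilde \<nu>"
    using \<open>\<nu> \<ge> 3\<close> by (simp add: B2_def B2_tilde_def divide_right_mono)
qed

end
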